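(* Let $T>0$, let $(E,A)$ with $E,A\in\mathbb{R}^{n\times n}$ be a regular matrix pair, and let $P,Q\in\mathbb{R}^{n\times n}$ be non-singular matrices transforming $(E,A)$ to Weierstrass canonical form, $$PEQ=\begin{bmatrix} I_{n_1}&0\\0&N\end{bmatrix},\qquad PAQ=\begin{bmatrix} J&0\\0&I_{n_2}\end{bmatrix},\qquad n_1+n_2=n,$$ where $J\in\mathbb{R}^{n_1\times n_1}$ is in Jordan canonical form and $N\in\mathbb{R}^{n_2\times n_2}$ is nilpotent and in Jordan canonical form. Let $\nu=\mathrm{ind}(E,A)$, let $f\in C^{\nu}([0,T],\mathbb{R}^n)$, and write $Pf=\begin{bmatrix}\tilde f_1\\ \tilde f_2\end{bmatrix}$ with $\tilde f_j:[0,T]\to\mathbb{R}^{n_j}$. Let $\tilde B_1,\tilde C_1\in\mathbb{R}^{n_1\times n_1}$, $\tilde B_2,\tilde C_2\in\mathbb{R}^{n_1\times n_2}$, $d_1\in\mathbb{R}^{n_1}$ and $$\tilde B=\begin{bmatrix}\tilde B_1&\tilde B_2\\0&0\end{bmatrix},\quad \tilde C=\begin{bmatrix}\tilde C_1&\tilde C_2\\0&0\end{bmatrix}\in\mathbb{R}^{n\times n},\quad B=\tilde BQ^{-1},\quad C=\tilde CQ^{-1},\quad d=\begin{bmatrix}d_1\\0\end{bmatrix}\in\mathbb{R}^n .$$ Assume that the matrix $$\tilde D=\tilde B_1+\tilde C_1+\tilde C_1J\int_0^T e^{(T-s)J}\,ds$$ is non-singular. Then the boundary value problem $$E\dot x(t)=Ax(t)+f(t),\quad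 t\in(0,T),\qquad Bx(0)+Cx(T)=d,$$ has a unique solution $x\in C^1([0,T],\mathbb{R}^n)$, and it is given by $$x(t)=Q(\tilde\mu+\tilde u(t)),\qquad \tilde\mu=\begin{bmatrix}\tilde\mu_1\\ \tilde\mu_2\end{bmatrix},\quad \tilde u(t)=\begin{bmatrix}\tilde u_1(t)\\ \tilde u_2(t)\end{bmatrix},$$ where $$\tilde\mu_1=\tilde D^{-1}\tilde d,\qquad \tilde u_1(t)=\int_0^t e^{(t-s)J}\,ds\,J\tilde D^{-1}\tilde d+\int_0^t e^{(t-s)J}\tilde f_1(s)\,ds,$$ $$\tilde\mu_2=-\sum_{i=0}^{\nu-1}N^i\tilde f_2^{(i)}(0),\qquad \tilde u_2(t)=-\sum_{i=0}^{\nu-1}N^i\bigl[\tilde f_2^{(i)}(t)-\tilde f_2^{(i)}(0)\bigr],$$ and $$\tilde d=d_1-\tilde C_1\int_0^T e^{(T-s)J}\tilde f_1(s)\,ds+\tilde B_2\sum_{i=0}^{\nu-1}N^i\tilde f_2^{(i)}(0)+\tilde C_2\sum_{i=0}^{\nu-1}N^i\tilde f_2^{(i)}(T).$$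
   Context: A pair $(E,A)$ of real $n\times n$ matrices is regular if $\det(\lambda E-A)\neq0$ for some $\lambda\in\mathbb{C}$. The index $\mathrm{ind}(E,A)$ is the index of nilpotency of the block $N$ in the Weierstrass canonical form, i.e. the least $\nu$ with $N^\nu=0$ (with $\nu=0$ and empty sums equal to $0$ if $n_2=0$). A superscript $(i)$ on a function denotes the $i$-th derivative. A solution of the boundary value problem is a function $x\in C^1([0,T],\mathbb{R}^n)$ satisfying the differential-algebraic equation on $(0,T)$ and the boundary condition. *)

theory Defs
  imports "HOL-Analysis.Analysis" "Jordan_Normal_Form.Jordan_Normal_Form"
    "Jordan_Normal_Form.Gauss_Jordan_Elimination"
begin

text \<open>Matrices and vectors are those of Jordan_Normal_Form, whose dimensions are natural numbers
  and may be 0: the blocks of size \<open>n\<^sub>1\<close> and \<open>n\<^sub>2\<close> of a Weierstrass canonical form may be empty.\<close>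

unbundle no vec_syntax
hide_type (open) Finite_Cartesian_Product.vec
hide_const (open) Finite_Cartesian_Product.vec Finite_Cartesian_Product.mat Determinants.det
  Finite_Cartesian_Product.row

subsection \<open>Matrix pairs\<close>

definition in_jordan_form :: "'a :: field mat \<Rightarrow> bool" where
  "in_jordan_form M \<longleftrightarrow> (\<exists>n_as. 0 \<notin> fst ` set n_as \<and> M = jordan_matrix n_as)"

definition nilpotent_mat :: "'a :: field mat \<Rightarrow> bool" where
  "nilpotent_mat N \<longleftrightarrow> (\<exists>k. N ^\<^sub>m k = 0\<^sub>m (dim_row N) (dim_row N))"

text \<open>For the \<open>0 \<times> 0\<close> matrix this is 0.\<close>

definition nilpotency_index :: "'a :: field mat \<Rightarrow> nat" where
  "nilpotency_index N = (LEAST k. N ^\<^sub>m k = 0\<^sub>m (dim_row N) (dim_row N))"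

definition weierstrass_form ::
  "nat \<Rightarrow> 'a :: field mat \<Rightarrow> 'a mat \<Rightarrow> 'a mat \<Rightarrow> 'a mat \<Rightarrow> nat \<Rightarrow> 'a mat \<Rightarrow> nat \<Rightarrow> 'a mat \<Rightarrow> bool" where
  "weierstrass_form n E A P Q n1 J n2 N \<longleftrightarrow>
     n1 + n2 = n \<and>
     P \<in> carrier_mat n n \<and> invertible_mat P \<and>
     Q \<in> carrier_mat n n \<and> invertible_mat Q \<and>
     J \<in> carrier_mat n1 n1 \<and> in_jordan_form J \<and>
     N \<in> carrier_mat n2 n2 \<and> in_jordan_form N \<and> nilpotent_mat N \<and>
     P * E * Q = four_block_mat (1\<^sub>m n1) (0\<^sub>m n1 n2) (0\<^sub>m n2 n1) N \<and>
     P * A * Q = four_block_mat J (0\<^sub>m n1 n2) (0\<^sub>m n2 n1) (1\<^sub>m n2)"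

abbreviation complex_mat :: "real mat \<Rightarrow> complex mat" where
  "complex_mat \<equiv> map_mat complex_of_real"

definition regular_pair :: "real mat \<Rightarrow> real mat \<Rightarrow> bool" where
  "regular_pair E A \<longleftrightarrow> (\<exists>l :: complex. det (l \<cdot>\<^sub>m complex_mat E - complex_mat A) \<noteq> 0)"

text \<open>The index does not depend on the chosen canonical form. The canonical form is taken over the
  complex numbers, so that it exists for every regular real pair; a real one, if there is one, is
  also a complex one, with the same \<open>N\<close>.\<close>

definition pair_index :: "real mat \<Rightarrow> real mat \<Rightarrow> nat" where
  "pair_index E A = (THE \<nu>. \<exists>P Q n1 J n2 N.
     weierstrass_form (dim_row E) (complex_mat E) (complex_mat A) P Q n1 J n2 N \<and>
     \<nu> = nilpotency_index N)"

text \<open>Meaningful only for an invertible square matrix.\<close>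

abbreviation inv_mat :: "'a :: field mat \<Rightarrow> 'a mat" where
  "inv_mat M \<equiv> the (mat_inverse M)"

subsection \<open>Entrywise analysis of vector- and matrix-valued functions\<close>

definition mat_exp :: "real mat \<Rightarrow> real mat" where
  "mat_exp M = mat (dim_row M) (dim_row M) (\<lambda>(i, j). \<Sum>k. (M ^\<^sub>m k) $$ (i, j) / fact k)"

definition vec_integral :: "nat \<Rightarrow> real \<Rightarrow> real \<Rightarrow> (real \<Rightarrow> real vec) \<Rightarrow> real vec" where
  "vec_integral n a b g = vec n (\<lambda>i. integral {a..b} (\<lambda>s. g s $ i))"

definition mat_integral :: "nat \<Rightarrow> real \<Rightarrow> real \<Rightarrow> (real \<Rightarrow> real mat) \<Rightarrow> real mat" where
  "mat_integral n a b G = mat n n (\<lambda>(i, j). integral {a..b} (\<lambda>s. G s $$ (i, j)))"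

text \<open>Derivatives are taken within \<open>S\<close>: on a compact interval they are one-sided at the end points
  and the usual ones in the interior.\<close>

primrec nth_deriv_on :: "real set \<Rightarrow> nat \<Rightarrow> (real \<Rightarrow> real) \<Rightarrow> real \<Rightarrow> real" where
  "nth_deriv_on S 0 g = g"
| "nth_deriv_on S (Suc i) g = (\<lambda>t. vector_derivative (nth_deriv_on S i g) (at t within S))"

definition Ck_on :: "nat \<Rightarrow> real set \<Rightarrow> (real \<Rightarrow> real) \<Rightarrow> bool" where
  "Ck_on k S g \<longleftrightarrow>
     (\<forall>i<k. nth_deriv_on S i g differentiable_on S) \<and> continuous_on S (nth_deriv_on S k g)"

definition vec_nth_deriv_on :: "real set \<Rightarrow> nat \<Rightarrow> (real \<Rightarrow> real vec) \<Rightarrow> real \<Rightarrow> real vec" where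
  "vec_nth_deriv_on S i g t = vec (dim_vec (g t)) (\<lambda>j. nth_deriv_on S i (\<lambda>s. g s $ j) t)"

definition vec_Ck_on :: "nat \<Rightarrow> real set \<Rightarrow> nat \<Rightarrow> (real \<Rightarrow> real vec) \<Rightarrow> bool" where
  "vec_Ck_on k S n g \<longleftrightarrow>
     (\<forall>t\<in>S. g t \<in> carrier_vec n) \<and> (\<forall>j<n. Ck_on k S (\<lambda>t. g t $ j))"

subsection \<open>The boundary value problem\<close>

definition bvp_solution ::
  "nat \<Rightarrow> real \<Rightarrow> real mat \<Rightarrow> real mat \<Rightarrow> (real \<Rightarrow> real vec) \<Rightarrow> real mat \<Rightarrow> real mat \<Rightarrow> real vec
    \<Rightarrow> (real \<Rightarrow> real vec) \<Rightarrow> bool" where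
  "bvp_solution n T E A f B C d x \<longleftrightarrow>
     vec_Ck_on 1 {0..T} n x \<and>
     (\<forall>t\<in>{0<..<T}. E *\<^sub>v vec_nth_deriv_on {0..T} 1 x t = A *\<^sub>v x t + f t) \<and>
     B *\<^sub>v x 0 + C *\<^sub>v x T = d"

end

theory Submission
  imports Defs
begin

text \<open>
  Writing \<open>x = Q (x\<^sub>1, x\<^sub>2)\<close> and multiplying the equation by the invertible matrix \<open>P\<close> splits it into two
  independent systems, \<open>x\<^sub>1' = J x\<^sub>1 + f\<^sub>1\<close> and \<open>N x\<^sub>2' = x\<^sub>2 + f\<^sub>2\<close> (\<open>weierstrass_decoupling\<close>).

  The first is an ordinary linear equation. Variation of constants gives, for every initial value \<open>z\<close>,
  the solution \<open>z + (\<integral> e\<^bsup>(t-s)J\<^esup> ds) J z + \<integral> e\<^bsup>(t-s)J\<^esup> f\<^sub>1(s) ds\<close>, the integrals running from \<open>0\<close> to \<open>t\<close>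
  (\<open>forced_linear_ode_solution\<close>); the first two summands together are \<open>e\<^bsup>tJ\<^esup> z\<close>. In the second system
  \<open>N\<close> is nilpotent, so \<open>x\<^sub>2\<close> is not free: the telescoping sum \<open>- \<Sum> N\<^sup>i f\<^sub>2\<^bsup>(i)\<^esup>\<close> is a
  solution (\<open>nilpotent_dae_solution\<close>). That sum stops below the index because the power
  \<open>N\<^sup>\<nu>\<close> vanishes. The index is defined through an arbitrary complex canonical form, so this rests on the fact that
  all Weierstrass forms of a pair have nilpotent blocks of the same index (\<open>weierstrass_forms_pow_zero\<close>).

  With these solutions the boundary condition becomes the linear system \<open>D z = d\<close> for \<open>z = x\<^sub>1(0)\<close>, with \<open>D\<close> the
  matrix that is assumed invertible: the matrix exponential integral commutes with \<open>J\<close>, which turns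
  \<open>C\<^sub>1 J \<integral> e\<^bsup>(T-s)J\<^esup> ds z\<close> into \<open>C\<^sub>1\<close> applied to the second summand above at time \<open>T\<close>.

  For uniqueness, the difference of two solutions solves the homogeneous problem. Its second component
  satisfies \<open>N z' = z\<close> and vanishes although only one derivative is available
  (\<open>homogeneous_nilpotent_dae\<close>); its first component is \<open>e\<^bsup>tJ\<^esup> z(0)\<close> with \<open>D z(0) = 0\<close>
  (\<open>homogeneous_linear_bvp\<close>).
\<close>

section \<open>Inverses and powers of matrices\<close>

lemma inv_mat_props:
  fixes M :: "'a :: field mat"
  assumes M: "M \<in> carrier_mat n n" and inv: "invertible_mat M"
  shows "inv_mat M \<in> carrier_mat n n" "M * inv_mat M = 1\<^sub>m n" "inv_mat M * M = 1\<^sub>m n"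
proof -
  obtain B where B: "M * B = 1\<^sub>m n" "B * M = 1\<^sub>m (dim_row B)"
    using inv M unfolding invertible_mat_def inverts_mat_def by auto
  have "dim_col B = n" "dim_row B = n"
    using arg_cong[OF B(1), of dim_col] arg_cong[OF B(2), of dim_col] M by auto
  then have "M \<in> Units (ring_mat TYPE('a) n ())"
    using B M unfolding Units_def ring_mat_def by auto
  then obtain C where "mat_inverse M = Some C"
    using mat_inverse(1)[OF M, of "()"] by (cases "mat_inverse M") auto
  then show "inv_mat M \<in> carrier_mat n n" "M * inv_mat M = 1\<^sub>m n" "inv_mat M * M = 1\<^sub>m n"
    using mat_inverse(2)[OF M] by auto
qed

lemma pow_mat_Suc_left:
  fixes M :: "'a :: semiring_1 mat"
  assumes M: "M \<in> carrier_mat n n"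
  shows "M ^\<^sub>m Suc k = M * M ^\<^sub>m k"
proof (induction k)
  case (Suc k)
  have "M ^\<^sub>m Suc (Suc k) = (M * M ^\<^sub>m k) * M" using Suc by simp
  also have "\<dots> = M * (M ^\<^sub>m k * M)"
    by (rule assoc_mult_mat[OF M pow_carrier_mat[OF M] M])
  finally show ?case by simp
qed (use M in auto)

lemma pow_smult_mat:
  fixes M :: "'a :: comm_semiring_1 mat"
  assumes M: "M \<in> carrier_mat n n"
  shows "(c \<cdot>\<^sub>m M) ^\<^sub>m k = c ^ k \<cdot>\<^sub>m M ^\<^sub>m k"
proof (induction k)
  case (Suc k)
  have Mk: "M ^\<^sub>m k \<in> carrier_mat n n" by (rule pow_carrier_mat[OF M])
  have "(c \<cdot>\<^sub>m M) ^\<^sub>m Suc k = (c ^ k \<cdot>\<^sub>m M ^\<^sub>m k) * (c \<cdot>\<^sub>m M)" using Suc by simp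
  also have "\<dots> = c ^ k \<cdot>\<^sub>m (M ^\<^sub>m k * (c \<cdot>\<^sub>m M))"
    by (rule mult_smult_assoc_mat[OF Mk]) (use M in auto)
  also have "\<dots> = c ^ k \<cdot>\<^sub>m (c \<cdot>\<^sub>m (M ^\<^sub>m k * M))"
    by (subst mult_smult_distrib[OF Mk M]) simp
  finally show ?case by (intro eq_matI) (auto simp: ac_simps)
qed (intro eq_matI, use M in auto)

lemma index_mult_mat_sum:
  assumes "A \<in> carrier_mat nr n" "B \<in> carrier_mat n nc" "i < nr" "j < nc"
  shows "(A * B) $$ (i, j) = (\<Sum>l<n. A $$ (i, l) * B $$ (l, j))"
  using assms by (simp add: scalar_prod_def atLeast0LessThan)

lemma index_mult_vec_sum:
  assumes "A \<in> carrier_mat nr n" "v \<in> carrier_vec n" "i < nr"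
  shows "(A *\<^sub>v v) $ i = (\<Sum>l<n. A $$ (i, l) * v $ l)"
  using assms by (simp add: scalar_prod_def atLeast0LessThan)

lemma four_block_mat_eqD:
  assumes "four_block_mat A1 B1 C1 D1 = four_block_mat A2 B2 C2 D2"
    and "A1 \<in> carrier_mat nr1 nc1" "A2 \<in> carrier_mat nr1 nc1"
    and "B1 \<in> carrier_mat nr1 nc2" "B2 \<in> carrier_mat nr1 nc2"
    and "C1 \<in> carrier_mat nr2 nc1" "C2 \<in> carrier_mat nr2 nc1"
    and "D1 \<in> carrier_mat nr2 nc2" "D2 \<in> carrier_mat nr2 nc2"
  shows "A1 = A2" "B1 = B2" "C1 = C2" "D1 = D2"
proof -
  have *: "four_block_mat A1 B1 C1 D1 $$ (i, j) = four_block_mat A2 B2 C2 D2 $$ (i, j)" for i j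
    using assms(1) by simp
  show "A1 = A2"
  proof (rule eq_matI)
    fix i j assume "i < dim_row A2" "j < dim_col A2"
    then show "A1 $$ (i, j) = A2 $$ (i, j)" using *[of i j] assms(2-) by auto
  qed (use assms in auto)
  show "B1 = B2"
  proof (rule eq_matI)
    fix i j assume "i < dim_row B2" "j < dim_col B2"
    then show "B1 $$ (i, j) = B2 $$ (i, j)" using *[of i "nc1 + j"] assms(2-) by auto
  qed (use assms in auto)
  show "C1 = C2"
  proof (rule eq_matI)
    fix i j assume "i < dim_row C2" "j < dim_col C2"
    then show "C1 $$ (i, j) = C2 $$ (i, j)" using *[of "nr1 + i" j] assms(2-) by auto
  qed (use assms in auto)
  show "D1 = D2"
  proof (rule eq_matI)
    fix i j assume "i < dim_row D2" "j < dim_col D2"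
    then show "D1 $$ (i, j) = D2 $$ (i, j)" using *[of "nr1 + i" "nc1 + j"] assms(2-) by auto
  qed (use assms in auto)
qed

section \<open>The index of a matrix pair\<close>

text \<open>Two block diagonal pencils that are equivalent through \<open>R\<close> and \<open>S\<close>. Comparing lower left blocks gives
  \<open>R\<^sub>3 = N' R\<^sub>3 J\<close>, hence \<open>R\<^sub>3 = N'\<^sup>l R\<^sub>3 J\<^sup>l\<close> for all \<open>l\<close>, and nilpotency of \<open>N'\<close> forces \<open>R\<^sub>3 = 0\<close>. Then the
  lower right block \<open>R\<^sub>4\<close> inherits a right inverse from \<open>R\<close>, and it intertwines: \<open>R\<^sub>4 N = N' R\<^sub>4\<close>. So every power
  of \<open>N\<close> that vanishes also vanishes for \<open>N'\<close>.\<close>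

lemma block_diag_pencil_pow_zero:
  fixes N N' :: "'a :: field mat"
  assumes J: "J \<in> carrier_mat n1 n1" and N: "N \<in> carrier_mat n2 n2"
    and J': "J' \<in> carrier_mat m1 m1" and N': "N' \<in> carrier_mat m2 m2"
    and R: "R \<in> carrier_mat (m1 + m2) (n1 + n2)" and S: "S \<in> carrier_mat (m1 + m2) (n1 + n2)"
    and Ri: "Ri \<in> carrier_mat (n1 + n2) (m1 + m2)" and R_Ri: "R * Ri = 1\<^sub>m (m1 + m2)"
    and eqE: "R * four_block_mat (1\<^sub>m n1) (0\<^sub>m n1 n2) (0\<^sub>m n2 n1) N =
      four_block_mat (1\<^sub>m m1) (0\<^sub>m m1 m2) (0\<^sub>m m2 m1) N' * S"
    and eqA: "R * four_block_mat J (0\<^sub>m n1 n2) (0\<^sub>m n2 n1) (1\<^sub>m n2) =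
      four_block_mat J' (0\<^sub>m m1 m2) (0\<^sub>m m2 m1) (1\<^sub>m m2) * S"
    and nil: "nilpotent_mat N'" and zero: "N ^\<^sub>m k = 0\<^sub>m n2 n2"
  shows "N' ^\<^sub>m k = 0\<^sub>m m2 m2"
proof -
  obtain R1 R2 R3 R4 where "split_block R m1 n1 = (R1, R2, R3, R4)" by (metis prod_cases4)
  note Rb = split_block[OF this, of m2 n2]
  obtain S1 S2 S3 S4 where "split_block S m1 n1 = (S1, S2, S3, S4)" by (metis prod_cases4)
  note Sb = split_block[OF this, of m2 n2]
  obtain T1 T2 T3 T4 where "split_block Ri n1 m1 = (T1, T2, T3, T4)" by (metis prod_cases4)
  note Tb = split_block[OF this, of n2 m2]
  have Rc: "R1 \<in> carrier_mat m1 n1" "R2 \<in> carrier_mat m1 n2" "R3 \<in> carrier_mat m2 n1"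
      "R4 \<in> carrier_mat m2 n2" "R = four_block_mat R1 R2 R3 R4" using Rb R by auto
  have Sc: "S1 \<in> carrier_mat m1 n1" "S2 \<in> carrier_mat m1 n2" "S3 \<in> carrier_mat m2 n1"
      "S4 \<in> carrier_mat m2 n2" "S = four_block_mat S1 S2 S3 S4" using Sb S by auto
  have Tc: "T1 \<in> carrier_mat n1 m1" "T2 \<in> carrier_mat n1 m2" "T3 \<in> carrier_mat n2 m1"
      "T4 \<in> carrier_mat n2 m2" "Ri = four_block_mat T1 T2 T3 T4" using Tb Ri by auto
  have "R * four_block_mat (1\<^sub>m n1) (0\<^sub>m n1 n2) (0\<^sub>m n2 n1) N =
      four_block_mat R1 (R2 * N) R3 (R4 * N)"
    unfolding Rc(5) by (subst mult_four_block_mat[OF Rc(1-4)]) (use Rc N in auto)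
  moreover have "four_block_mat (1\<^sub>m m1) (0\<^sub>m m1 m2) (0\<^sub>m m2 m1) N' * S =
      four_block_mat S1 S2 (N' * S3) (N' * S4)"
    unfolding Sc(5) by (subst mult_four_block_mat[OF _ _ _ _ Sc(1-4)]) (use Sc N' in auto)
  ultimately have "four_block_mat R1 (R2 * N) R3 (R4 * N) =
      four_block_mat S1 S2 (N' * S3) (N' * S4)" using eqE by simp
  note E_blocks = four_block_mat_eqD[OF this, of m1 n1 n2 m2]
  have "R * four_block_mat J (0\<^sub>m n1 n2) (0\<^sub>m n2 n1) (1\<^sub>m n2) =
      four_block_mat (R1 * J) R2 (R3 * J) R4"
    unfolding Rc(5) by (subst mult_four_block_mat[OF Rc(1-4)]) (use Rc J in auto)
  moreover have "four_block_mat J' (0\<^sub>m m1 m2) (0\<^sub>m m2 m1) (1\<^sub>m m2) * S =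
      four_block_mat (J' * S1) (J' * S2) S3 S4"
    unfolding Sc(5) by (subst mult_four_block_mat[OF _ _ _ _ Sc(1-4)]) (use Sc J' in auto)
  ultimately have "four_block_mat (R1 * J) R2 (R3 * J) R4 =
      four_block_mat (J' * S1) (J' * S2) S3 S4" using eqA by simp
  note A_blocks = four_block_mat_eqD[OF this, of m1 n1 n2 m2]
  have R3: "R3 = N' * (R3 * J)" and R4: "R4 * N = N' * R4"
    using E_blocks(3,4) A_blocks(3,4) Rc Sc J J' N N' by auto
  have R3_iter: "R3 = N' ^\<^sub>m l * (R3 * J ^\<^sub>m l)" for l
  proof (induction l)
    case 0
    then show ?case using Rc J N' by auto
  next
    case (Suc l)
    note c = pow_carrier_mat[OF N', of l] pow_carrier_mat[OF J, of l]
    have "R3 = N' ^\<^sub>m l * ((N' * (R3 * J)) * J ^\<^sub>m l)" using Suc R3 by simp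
    also have "(N' * (R3 * J)) * J ^\<^sub>m l = N' * (R3 * (J * J ^\<^sub>m l))"
      using Rc(3) J N' c by (simp add: assoc_mult_mat[of _ m2 m2 _ n1 _ n1]
          assoc_mult_mat[of _ m2 n1 _ n1 _ n1])
    also have "N' ^\<^sub>m l * \<dots> = (N' ^\<^sub>m l * N') * (R3 * (J * J ^\<^sub>m l))"
      by (rule assoc_mult_mat[symmetric, OF c(1) N']) (use Rc J c in auto)
    finally show ?case using pow_mat_Suc_left[OF J, of l] by simp
  qed
  obtain l where "N' ^\<^sub>m l = 0\<^sub>m m2 m2" using nil N' unfolding nilpotent_mat_def by auto
  then have R3_0: "R3 = 0\<^sub>m m2 n1"
    using R3_iter[of l] Rc J by simp
  have "R * Ri = four_block_mat (R1 * T1 + R2 * T3) (R1 * T2 + R2 * T4) (R4 * T3) (R4 * T4)"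
    unfolding Rc(5) Tc(5) by (subst mult_four_block_mat[OF Rc(1-4) Tc(1-4)])
      (use Rc Tc R3_0 in auto)
  then have "four_block_mat (R1 * T1 + R2 * T3) (R1 * T2 + R2 * T4) (R4 * T3) (R4 * T4) =
      four_block_mat (1\<^sub>m m1) (0\<^sub>m m1 m2) (0\<^sub>m m2 m1) (1\<^sub>m m2)"
    using R_Ri by simp
  from four_block_mat_eqD(4)[OF this, of m1 m1 m2 m2] have R4_T4: "R4 * T4 = 1\<^sub>m m2"
    using Rc Tc by auto
  \<comment> \<open>The intertwining relation passes to powers, and \<open>R\<^sub>4\<close> can then be cancelled on the right.\<close>
  have N'_pow: "N' ^\<^sub>m l * R4 = R4 * N ^\<^sub>m l" for l
  proof (induction l)
    case 0
    then show ?case using Rc N N' by simp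
  next
    case (Suc l)
    note c = pow_carrier_mat[OF N', of l] pow_carrier_mat[OF N, of l]
    have "N' ^\<^sub>m Suc l * R4 = N' * N' ^\<^sub>m l * R4" using pow_mat_Suc_left[OF N'] by simp
    also have "\<dots> = N' * (R4 * N ^\<^sub>m l)"
      using assoc_mult_mat[OF N' c(1) Rc(4)] Suc by simp
    also have "\<dots> = (R4 * N) * N ^\<^sub>m l"
      using assoc_mult_mat[OF N' Rc(4) c(2)] R4 by simp
    also have "\<dots> = R4 * N ^\<^sub>m Suc l"
      using assoc_mult_mat[OF Rc(4) N c(2)] pow_mat_Suc_left[OF N, of l] by simp
    finally show ?case .
  qed
  have c: "N' ^\<^sub>m k \<in> carrier_mat m2 m2" by (rule pow_carrier_mat[OF N'])
  have "N' ^\<^sub>m k = N' ^\<^sub>m k * (R4 * T4)" unfolding R4_T4 by (rule right_mult_one_mat[OF c, symmetric])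
  also have "\<dots> = (N' ^\<^sub>m k * R4) * T4" using assoc_mult_mat[OF c Rc(4) Tc(4)] by simp
  also have "\<dots> = 0\<^sub>m m2 m2" using N'_pow[of k] zero Rc Tc by simp
  finally show ?thesis .
qed

text \<open>The equivalence of the two forms is \<open>R = P' P\<^sup>-\<^sup>1\<close>, \<open>S = Q'\<^sup>-\<^sup>1 Q\<close>; by symmetry the two nilpotent blocks
  have the same index.\<close>

lemma weierstrass_forms_pow_zero:
  fixes E A :: "'a :: field mat"
  assumes E: "E \<in> carrier_mat n n" and A: "A \<in> carrier_mat n n"
    and W: "weierstrass_form n E A P Q n1 J n2 N"
    and W': "weierstrass_form n E A P' Q' m1 J' m2 N'"
    and zero: "N ^\<^sub>m k = 0\<^sub>m n2 n2"
  shows "N' ^\<^sub>m k = 0\<^sub>m m2 m2"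
proof -
  note w = W[unfolded weierstrass_form_def] and w' = W'[unfolded weierstrass_form_def]
  have n: "n1 + n2 = n" "m1 + m2 = n" using w w' by auto
  have P: "P \<in> carrier_mat n n" "invertible_mat P" and Q: "Q \<in> carrier_mat n n" "invertible_mat Q"
    and P': "P' \<in> carrier_mat n n" "invertible_mat P'"
    and Q': "Q' \<in> carrier_mat n n" "invertible_mat Q'" using w w' by auto
  note Pi = inv_mat_props[OF P] and Pi' = inv_mat_props[OF P'] and Qi' = inv_mat_props[OF Q']
  define R where "R = P' * inv_mat P"
  define S where "S = inv_mat Q' * Q"
  define Ri where "Ri = P * inv_mat P'"
  have c: "R \<in> carrier_mat n n" "S \<in> carrier_mat n n" "Ri \<in> carrier_mat n n"
    using P Q P' Q' Pi Pi' Qi' unfolding R_def S_def Ri_def by auto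
  have assoc: "X * Y * Z = X * (Y * Z)"
    if "X \<in> carrier_mat n n" "Y \<in> carrier_mat n n" "Z \<in> carrier_mat n n" for X Y Z :: "'a mat"
    using that by simp
  have closed: "X * Y \<in> carrier_mat n n"
    if "X \<in> carrier_mat n n" "Y \<in> carrier_mat n n" for X Y :: "'a mat"
    using that by simp
  have cancel: "inv_mat P * (P * X) = X" "Q' * (inv_mat Q' * X) = X"
    if "X \<in> carrier_mat n n" for X
    using that assoc[OF Pi(1) P(1) that] assoc[OF Q'(1) Qi'(1) that] Pi(3) Qi'(2) by auto
  have "R * Ri = P' * (inv_mat P * (P * inv_mat P'))"
    unfolding R_def Ri_def by (rule assoc) (use P P' Pi Pi' in auto)
  then have R_Ri: "R * Ri = 1\<^sub>m n" using cancel(1)[OF Pi'(1)] Pi'(2) by simp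
  have swap: "R * (P * X * Q) = (P' * X * Q') * S" if X: "X \<in> carrier_mat n n" for X
  proof -
    have "R * (P * X * Q) = P' * (inv_mat P * (P * (X * Q)))"
      unfolding R_def using assoc closed P(1) Q(1) P'(1) Pi(1) X by metis
    also have "\<dots> = P' * (X * (Q' * (inv_mat Q' * Q)))"
      using cancel Q X by simp
    also have "\<dots> = (P' * X * Q') * S"
      unfolding S_def using assoc closed P'(1) Q'(1) Q(1) Qi'(1) X by metis
    finally show ?thesis .
  qed
  show ?thesis
    by (rule block_diag_pencil_pow_zero[of J n1 N n2 J' m1 N' m2 R S Ri k])
      (use w w' n c R_Ri swap[OF E] swap[OF A] zero in auto)
qed

lemma map_mat_jordan_matrix:
  assumes "f 0 = 0" and "f 1 = 1"
  shows "map_mat f (jordan_matrix n_as) = jordan_matrix (map (\<lambda>(n, a). (n, f a)) n_as)"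
proof (induction n_as)
  case Nil
  then show ?case unfolding jordan_matrix_def by (intro eq_matI) auto
next
  case (Cons na n_as)
  obtain n a where na: "na = (n, a)" by force
  have *: "jordan_matrix ((n, a) # n_as) = four_block_mat (jordan_block n a)
      (0\<^sub>m n (dim_col (jordan_matrix n_as))) (0\<^sub>m (dim_row (jordan_matrix n_as)) n)
      (jordan_matrix n_as)" for n a and n_as :: "(nat \<times> 'c :: {zero, one}) list"
    by (simp add: jordan_matrix_def Let_def)
  have "map_mat f (jordan_block n a) = jordan_block n (f a)"
    using assms by (intro eq_matI) auto
  moreover have "map_mat f (0\<^sub>m i j) = 0\<^sub>m i j" for i j using assms by (intro eq_matI) auto
  ultimately show ?case unfolding na list.map split *
    by (subst map_four_block_mat) (auto simp: Cons[symmetric])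
qed

lemma in_jordan_form_complex_mat: "in_jordan_form M \<Longrightarrow> in_jordan_form (complex_mat M)"
proof -
  assume "in_jordan_form M"
  then obtain n_as where n_as: "0 \<notin> fst ` set n_as" "M = jordan_matrix n_as"
    unfolding in_jordan_form_def by auto
  have "fst ` set (map (\<lambda>(n, a). (n, complex_of_real a)) n_as) = fst ` set n_as" by force
  then show ?thesis unfolding in_jordan_form_def n_as(2)
    using n_as(1) map_mat_jordan_matrix[of complex_of_real n_as] by (metis of_real_0 of_real_1)
qed

lemma complex_mat_pow_zero_iff:
  assumes N: "N \<in> carrier_mat n n"
  shows "complex_mat N ^\<^sub>m k = 0\<^sub>m n n \<longleftrightarrow> N ^\<^sub>m k = 0\<^sub>m n n"
proof -
  have "complex_mat N ^\<^sub>m k = complex_mat (N ^\<^sub>m k)"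
    using of_real_hom.mat_hom_pow[OF N] by metis
  moreover have "complex_mat (0\<^sub>m n n) = 0\<^sub>m n n" by (intro eq_matI) auto
  ultimately show ?thesis using of_real_hom.mat_hom_inj by metis
qed

lemma invertible_complex_mat:
  assumes M: "M \<in> carrier_mat n n" and inv: "invertible_mat M"
  shows "invertible_mat (complex_mat M)"
proof -
  note i = inv_mat_props[OF M inv]
  have "complex_mat M * complex_mat (inv_mat M) = 1\<^sub>m n"
    "complex_mat (inv_mat M) * complex_mat M = 1\<^sub>m n"
    using of_real_hom.mat_hom_mult[OF M i(1)] of_real_hom.mat_hom_mult[OF i(1) M] i(2,3)
      of_real_hom.mat_hom_one by metis+
  then show ?thesis using M i(1) unfolding invertible_mat_def inverts_mat_def by auto
qed

text \<open>Needed because the index of a real pair is read off from its complex canonical forms.\<close>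

lemma weierstrass_form_complex:
  assumes E: "E \<in> carrier_mat n n" and A: "A \<in> carrier_mat n n"
    and W: "weierstrass_form n E A P Q n1 J n2 N"
  shows "weierstrass_form n (complex_mat E) (complex_mat A) (complex_mat P) (complex_mat Q)
    n1 (complex_mat J) n2 (complex_mat N)"
proof -
  note w = W[unfolded weierstrass_form_def]
  have P: "P \<in> carrier_mat n n" and Q: "Q \<in> carrier_mat n n" and J: "J \<in> carrier_mat n1 n1"
    and N: "N \<in> carrier_mat n2 n2" using w by auto
  have hom: "complex_mat P * complex_mat X * complex_mat Q = complex_mat (P * X * Q)"
    if X: "X \<in> carrier_mat n n" for X
    using of_real_hom.mat_hom_mult[OF P X] of_real_hom.mat_hom_mult[of "P * X" n n Q n] P X Q
    by (metis mult_carrier_mat)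
  have z: "complex_mat (0\<^sub>m i j) = 0\<^sub>m i j" "complex_mat (1\<^sub>m i) = 1\<^sub>m i" for i j
    by (auto intro!: eq_matI)
  have "nilpotent_mat (complex_mat N)"
    using w complex_mat_pow_zero_iff[OF N] N unfolding nilpotent_mat_def by auto
  moreover have "complex_mat P * complex_mat E * complex_mat Q =
      four_block_mat (1\<^sub>m n1) (0\<^sub>m n1 n2) (0\<^sub>m n2 n1) (complex_mat N)"
  proof -
    have "P * E * Q = four_block_mat (1\<^sub>m n1) (0\<^sub>m n1 n2) (0\<^sub>m n2 n1) N" using w by simp
    then show ?thesis unfolding hom[OF E]
      using map_four_block_mat[of "1\<^sub>m n1" n1 n1 "0\<^sub>m n1 n2" n2 "0\<^sub>m n2 n1" n2 N complex_of_real] N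
      by (simp add: z)
  qed
  moreover have "complex_mat P * complex_mat A * complex_mat Q =
      four_block_mat (complex_mat J) (0\<^sub>m n1 n2) (0\<^sub>m n2 n1) (1\<^sub>m n2)"
  proof -
    have "P * A * Q = four_block_mat J (0\<^sub>m n1 n2) (0\<^sub>m n2 n1) (1\<^sub>m n2)" using w by simp
    then show ?thesis unfolding hom[OF A]
      using map_four_block_mat[of J n1 n1 "0\<^sub>m n1 n2" n2 "0\<^sub>m n2 n1" n2 "1\<^sub>m n2" complex_of_real] J
      by (simp add: z)
  qed
  ultimately show ?thesis
    using w invertible_complex_mat in_jordan_form_complex_mat unfolding weierstrass_form_def by auto
qed

lemma pair_index_eq_nilpotency_index:
  assumes E: "E \<in> carrier_mat n n" and A: "A \<in> carrier_mat n n"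
    and W: "weierstrass_form n E A P Q n1 J n2 N"
  shows "pair_index E A = nilpotency_index N"
proof -
  have N: "N \<in> carrier_mat n2 n2" using W unfolding weierstrass_form_def by auto
  note WC = weierstrass_form_complex[OF E A W]
  have EC: "complex_mat E \<in> carrier_mat n n" and AC: "complex_mat A \<in> carrier_mat n n"
    using E A by auto
  have idx: "nilpotency_index (complex_mat N) = nilpotency_index N"
    using complex_mat_pow_zero_iff[OF N] N unfolding nilpotency_index_def by auto
  have uniq: "nilpotency_index N' = nilpotency_index N"
    if W': "weierstrass_form n (complex_mat E) (complex_mat A) P' Q' m1 J' m2 N'"
    for P' Q' m1 J' m2 N'
  proof -
    have N': "N' \<in> carrier_mat m2 m2" using W' unfolding weierstrass_form_def by auto
    have "N' ^\<^sub>m k = 0\<^sub>m m2 m2 \<longleftrightarrow> complex_mat N ^\<^sub>m k = 0\<^sub>m n2 n2" for k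
      using weierstrass_forms_pow_zero[OF EC AC WC W'] weierstrass_forms_pow_zero[OF EC AC W' WC]
      by blast
    then have "nilpotency_index N' = nilpotency_index (complex_mat N)"
      using N N' unfolding nilpotency_index_def by auto
    then show ?thesis using idx by simp
  qed
  show ?thesis unfolding pair_index_def
  proof (rule the_equality)
    show "\<exists>P Q n1 J n2 N'. weierstrass_form (dim_row E) (complex_mat E) (complex_mat A) P Q n1 J n2 N' \<and>
        nilpotency_index N = nilpotency_index N'"
      using WC idx E by (metis carrier_matD(1))
  qed (use uniq E in auto)
qed

lemma pow_pair_index_zero:
  assumes E: "E \<in> carrier_mat n n" and A: "A \<in> carrier_mat n n"
    and W: "weierstrass_form n E A P Q n1 J n2 N"
  shows "N ^\<^sub>m pair_index E A = 0\<^sub>m n2 n2"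
proof -
  have N: "N \<in> carrier_mat n2 n2" and nil: "nilpotent_mat N"
    using W unfolding weierstrass_form_def by auto
  then obtain k where "N ^\<^sub>m k = 0\<^sub>m n2 n2" unfolding nilpotent_mat_def by auto
  then show ?thesis unfolding pair_index_eq_nilpotency_index[OF E A W] nilpotency_index_def
    using N by (metis (mono_tags, lifting) LeastI carrier_matD(1))
qed

section \<open>Continuously differentiable vector functions\<close>

text \<open>The derivative is carried along as an explicit function, so that closure properties can be stated
  without the choice operator hidden in \<^const>\<open>vector_derivative\<close>.\<close>

definition C1_with_deriv ::
  "real set \<Rightarrow> nat \<Rightarrow> (real \<Rightarrow> real vec) \<Rightarrow> (real \<Rightarrow> real vec) \<Rightarrow> bool" where
  "C1_with_deriv S n g g' \<longleftrightarrow>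
     (\<forall>t\<in>S. g t \<in> carrier_vec n \<and> g' t \<in> carrier_vec n) \<and>
     (\<forall>i<n. (\<forall>t\<in>S. ((\<lambda>s. g s $ i) has_real_derivative g' t $ i) (at t within S)) \<and>
       continuous_on S (\<lambda>t. g' t $ i))"

lemma has_field_derivative_transform:
  fixes f g :: "real \<Rightarrow> real"
  assumes "t \<in> S" "\<And>s. s \<in> S \<Longrightarrow> g s = f s" "(f has_field_derivative D) (at t within S)"
  shows "(g has_field_derivative D) (at t within S)"
  using assms(3) by (rule has_field_derivative_transform_within[where d = 1])
    (use assms(1,2) in auto)

lemma C1_with_derivI:
  assumes "\<And>t. t \<in> S \<Longrightarrow> g t \<in> carrier_vec n" "\<And>t. t \<in> S \<Longrightarrow> g' t \<in> carrier_vec n"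
    and "\<And>i t. i < n \<Longrightarrow> t \<in> S \<Longrightarrow> ((\<lambda>s. g s $ i) has_real_derivative g' t $ i) (at t within S)"
    and "\<And>i. i < n \<Longrightarrow> continuous_on S (\<lambda>t. g' t $ i)"
  shows "C1_with_deriv S n g g'"
  using assms unfolding C1_with_deriv_def by auto

lemma C1_with_derivD:
  assumes "C1_with_deriv S n g g'"
  shows "t \<in> S \<Longrightarrow> g t \<in> carrier_vec n" "t \<in> S \<Longrightarrow> g' t \<in> carrier_vec n"
    and "i < n \<Longrightarrow> t \<in> S \<Longrightarrow> ((\<lambda>s. g s $ i) has_real_derivative g' t $ i) (at t within S)"
    and "i < n \<Longrightarrow> continuous_on S (\<lambda>t. g' t $ i)"
    and "i < n \<Longrightarrow> continuous_on S (\<lambda>t. g t $ i)"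
  using assms unfolding C1_with_deriv_def by (auto intro!: DERIV_continuous_on)

lemma C1_with_deriv_transform:
  assumes C1: "C1_with_deriv S n g g'"
    and g: "\<And>t. t \<in> S \<Longrightarrow> h t = g t" and g': "\<And>t. t \<in> S \<Longrightarrow> h' t = g' t"
  shows "C1_with_deriv S n h h'"
proof (rule C1_with_derivI)
  fix i t assume it: "i < n" "t \<in> S"
  have "((\<lambda>s. g s $ i) has_real_derivative h' t $ i) (at t within S)"
    using C1_with_derivD(3)[OF C1 it] g'[OF it(2)] by simp
  then show "((\<lambda>s. h s $ i) has_real_derivative h' t $ i) (at t within S)"
    by (rule has_field_derivative_transform[OF it(2), rotated]) (simp add: g)
next
  fix i assume i: "i < n"
  show "continuous_on S (\<lambda>t. h' t $ i)"
    using C1_with_derivD(4)[OF C1 i] by (rule continuous_on_eq) (simp add: g')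
qed (use C1_with_derivD[OF C1] g g' in auto)

lemma C1_with_deriv_mult_mat:
  assumes M: "M \<in> carrier_mat m n" and C1: "C1_with_deriv S n g g'"
  shows "C1_with_deriv S m (\<lambda>t. M *\<^sub>v g t) (\<lambda>t. M *\<^sub>v g' t)"
proof (rule C1_with_derivI)
  note c = C1_with_derivD[OF C1]
  fix i assume i: "i < m"
  have ix: "(M *\<^sub>v v) $ i = (\<Sum>l<n. M $$ (i, l) * v $ l)" if "v \<in> carrier_vec n" for v
    by (rule index_mult_vec_sum[OF M that i])
  show "continuous_on S (\<lambda>t. (M *\<^sub>v g' t) $ i)"
  proof (rule continuous_on_eq)
    show "continuous_on S (\<lambda>t. \<Sum>l<n. M $$ (i, l) * g' t $ l)"
      by (intro continuous_intros c) auto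
  qed (simp add: ix c)
  fix t assume t: "t \<in> S"
  have "((\<lambda>s. \<Sum>l<n. M $$ (i, l) * g s $ l) has_real_derivative (\<Sum>l<n. M $$ (i, l) * g' t $ l))
      (at t within S)"
    using c(3)[OF _ t] by (intro DERIV_sum DERIV_cmult) auto
  then show "((\<lambda>s. (M *\<^sub>v g s) $ i) has_real_derivative (M *\<^sub>v g' t) $ i) (at t within S)"
    unfolding ix[OF c(2)[OF t]]
    by (rule has_field_derivative_transform[OF t, rotated]) (simp add: ix c)
qed (use M C1_with_derivD(1,2)[OF C1] in \<open>auto intro: mult_mat_vec_carrier\<close>)

lemma C1_with_deriv_const: "c \<in> carrier_vec n \<Longrightarrow> C1_with_deriv S n (\<lambda>t. c) (\<lambda>t. 0\<^sub>v n)"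
  by (rule C1_with_derivI) auto

lemma C1_with_deriv_add:
  assumes "C1_with_deriv S n g g'" "C1_with_deriv S n h h'"
  shows "C1_with_deriv S n (\<lambda>t. g t + h t) (\<lambda>t. g' t + h' t)"
proof (rule C1_with_derivI)
  note c = C1_with_derivD[OF assms(1)] C1_with_derivD[OF assms(2)]
  fix i assume i: "i < n"
  show "continuous_on S (\<lambda>t. (g' t + h' t) $ i)"
    by (rule continuous_on_eq[OF continuous_on_add[OF c(4)[OF i] c(9)[OF i]]])
      (use c(2,7) i in force)
  fix t assume t: "t \<in> S"
  have ix: "(g s + h s) $ i = g s $ i + h s $ i" "(g' s + h' s) $ i = g' s $ i + h' s $ i" if "s \<in> S" for s
    using c(1,2,6,7)[OF that] i by auto
  show "((\<lambda>s. (g s + h s) $ i) has_real_derivative (g' t + h' t) $ i) (at t within S)"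
    unfolding ix(2)[OF t]
    by (rule has_field_derivative_transform[OF t _ DERIV_add[OF c(3)[OF i t] c(8)[OF i t]]])
      (simp add: ix)
qed (use C1_with_derivD[OF assms(1)] C1_with_derivD[OF assms(2)] in auto)

lemma C1_with_deriv_uminus:
  assumes "C1_with_deriv S n g g'"
  shows "C1_with_deriv S n (\<lambda>t. - g t) (\<lambda>t. - g' t)"
proof -
  have "C1_with_deriv S n (\<lambda>t. (- 1\<^sub>m n) *\<^sub>v g t) (\<lambda>t. (- 1\<^sub>m n) *\<^sub>v g' t)"
    by (rule C1_with_deriv_mult_mat[OF _ assms]) auto
  moreover have "(- 1\<^sub>m n) *\<^sub>v v = - v" if "v \<in> carrier_vec n" for v :: "real vec"
    using that by (auto intro!: eq_vecI)
  ultimately show ?thesis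
    using C1_with_derivD[OF assms] by (auto elim!: C1_with_deriv_transform)
qed

lemma C1_with_deriv_diff:
  assumes "C1_with_deriv S n g g'" "C1_with_deriv S n h h'"
  shows "C1_with_deriv S n (\<lambda>t. g t - h t) (\<lambda>t. g' t - h' t)"
proof -
  have *: "v - w = v + - w" if "v \<in> carrier_vec n" "w \<in> carrier_vec n" for v w :: "real vec"
    using that by (auto intro!: eq_vecI)
  show ?thesis
    by (rule C1_with_deriv_transform[OF C1_with_deriv_add[OF assms(1) C1_with_deriv_uminus[OF assms(2)]]])
      (use * C1_with_derivD[OF assms(1)] C1_with_derivD[OF assms(2)] in auto)
qed

lemma C1_with_deriv_finsum:
  assumes "finite I" "\<And>i. i \<in> I \<Longrightarrow> C1_with_deriv S n (g i) (g' i)"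
  shows "C1_with_deriv S n (\<lambda>t. finsum_vec TYPE(real) n (\<lambda>i. g i t) I)
    (\<lambda>t. finsum_vec TYPE(real) n (\<lambda>i. g' i t) I)"
proof (rule C1_with_derivI)
  note c = C1_with_derivD[OF assms(2)]
  have cl: "finsum_vec TYPE(real) n (\<lambda>i. g i t) I \<in> carrier_vec n"
    "finsum_vec TYPE(real) n (\<lambda>i. g' i t) I \<in> carrier_vec n" if "t \<in> S" for t
    using c(1,2) that by (auto intro!: finsum_vec_closed)
  then show "\<And>t. t \<in> S \<Longrightarrow> finsum_vec TYPE(real) n (\<lambda>i. g i t) I \<in> carrier_vec n"
    "\<And>t. t \<in> S \<Longrightarrow> finsum_vec TYPE(real) n (\<lambda>i. g' i t) I \<in> carrier_vec n" by auto
  fix j assume j: "j < n"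
  have ix: "finsum_vec TYPE(real) n (\<lambda>i. g i t) I $ j = (\<Sum>i\<in>I. g i t $ j)"
    "finsum_vec TYPE(real) n (\<lambda>i. g' i t) I $ j = (\<Sum>i\<in>I. g' i t $ j)" if "t \<in> S" for t
    using c(1,2) that by (auto intro!: index_finsum_vec assms(1) j)
  show "continuous_on S (\<lambda>t. finsum_vec TYPE(real) n (\<lambda>i. g' i t) I $ j)"
  proof (rule continuous_on_eq)
    show "continuous_on S (\<lambda>t. \<Sum>i\<in>I. g' i t $ j)"
      by (intro continuous_intros c j)
  qed (simp add: ix)
  fix t assume t: "t \<in> S"
  have "((\<lambda>s. \<Sum>i\<in>I. g i s $ j) has_real_derivative (\<Sum>i\<in>I. g' i t $ j)) (at t within S)"
    using c(3)[OF _ j t] by (intro DERIV_sum) auto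
  then show "((\<lambda>s. finsum_vec TYPE(real) n (\<lambda>i. g i s) I $ j) has_real_derivative
      finsum_vec TYPE(real) n (\<lambda>i. g' i t) I $ j) (at t within S)"
    unfolding ix(2)[OF t]
    by (rule has_field_derivative_transform[OF t, rotated]) (simp add: ix)
qed

lemma C1_with_deriv_append:
  assumes "C1_with_deriv S n g g'" "C1_with_deriv S m h h'"
  shows "C1_with_deriv S (n + m) (\<lambda>t. g t @\<^sub>v h t) (\<lambda>t. g' t @\<^sub>v h' t)"
proof (rule C1_with_derivI)
  note c = C1_with_derivD[OF assms(1)] and d = C1_with_derivD[OF assms(2)]
  fix i assume i: "i < n + m"
  have ix: "(g s @\<^sub>v h s) $ i = (if i < n then g s $ i else h s $ (i - n))"
     "(g' s @\<^sub>v h' s) $ i = (if i < n then g' s $ i else h' s $ (i - n))" if "s \<in> S" for s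
    using c(1,2)[OF that] d(1,2)[OF that] i by auto
  have d1: "continuous_on S (\<lambda>t. if i < n then g' t $ i else h' t $ (i - n))"
    using c(4)[of i] d(4)[of "i - n"] i by (cases "i < n") auto
  then show "continuous_on S (\<lambda>t. (g' t @\<^sub>v h' t) $ i)"
    by (rule continuous_on_eq) (simp only: ix)
  fix t assume t: "t \<in> S"
  have "((\<lambda>s. if i < n then g s $ i else h s $ (i - n)) has_real_derivative
    (if i < n then g' t $ i else h' t $ (i - n))) (at t within S)"
    using c(3)[of i, OF _ t] d(3)[of "i - n", OF _ t] i by (cases "i < n") auto
  then show "((\<lambda>s. (g s @\<^sub>v h s) $ i) has_real_derivative (g' t @\<^sub>v h' t) $ i) (at t within S)"
    unfolding ix(2)[OF t]
    by (rule has_field_derivative_transform[OF t, rotated]) (simp only: ix)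
qed (use C1_with_derivD[OF assms(1)] C1_with_derivD[OF assms(2)] in auto)

lemma C1_with_deriv_vec_first:
  assumes "C1_with_deriv S (n + m) g g'"
  shows "C1_with_deriv S n (\<lambda>t. vec_first (g t) n) (\<lambda>t. vec_first (g' t) n)"
  using assms unfolding C1_with_deriv_def vec_first_def by auto

lemma C1_with_deriv_vec_last:
  assumes "C1_with_deriv S (n + m) g g'"
  shows "C1_with_deriv S m (\<lambda>t. vec_last (g t) m) (\<lambda>t. vec_last (g' t) m)"
proof (rule C1_with_deriv_transform)
  note c = C1_with_derivD[OF assms]
  show "C1_with_deriv S m (\<lambda>t. vec m (\<lambda>i. g t $ (n + i))) (\<lambda>t. vec m (\<lambda>i. g' t $ (n + i)))"
    using assms unfolding C1_with_deriv_def by auto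
  show "vec_last (g t) m = vec m (\<lambda>i. g t $ (n + i))"
    "vec_last (g' t) m = vec m (\<lambda>i. g' t $ (n + i))" if "t \<in> S" for t
    using c(1,2)[OF that] unfolding vec_last_def by auto
qed

lemma Ck_on_derivs:
  assumes "Ck_on k {a..b} g" "a < b"
  shows "\<And>i t. i < k \<Longrightarrow> t \<in> {a..b} \<Longrightarrow>
      (nth_deriv_on {a..b} i g has_real_derivative nth_deriv_on {a..b} (Suc i) g t)
        (at t within {a..b})"
    and "\<And>i. i \<le> k \<Longrightarrow> continuous_on {a..b} (nth_deriv_on {a..b} i g)"
proof -
  fix i t assume "i < k" "t \<in> {a..b}"
  then have "nth_deriv_on {a..b} i g differentiable (at t within {a..b})"
    using assms unfolding Ck_on_def differentiable_on_def by auto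
  then show "(nth_deriv_on {a..b} i g has_real_derivative nth_deriv_on {a..b} (Suc i) g t)
        (at t within {a..b})"
    by (simp add: vector_derivative_works has_real_derivative_iff_has_vector_derivative)
next
  fix i assume "i \<le> k"
  then show "continuous_on {a..b} (nth_deriv_on {a..b} i g)"
    using assms unfolding Ck_on_def
    by (cases "i = k") (auto intro: differentiable_imp_continuous_on)
qed

text \<open>A chain of successive derivatives determines all the iterated ones. On a nondegenerate closed interval the one-sided
  derivatives at the end points are unique too, so the induction stays inside the interval.\<close>

lemma nth_deriv_on_unique:
  assumes ab: "a < b"
    and h0: "\<And>t. t \<in> {a..b} \<Longrightarrow> g t = h 0 t"
    and hS: "\<And>i t. i < k \<Longrightarrow> t \<in> {a..b} \<Longrightarrow>
      (h i has_real_derivative h (Suc i) t) (at t within {a..b})"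
    and i: "i \<le> k" and t: "t \<in> {a..b}"
  shows "nth_deriv_on {a..b} i g t = h i t"
  using i t
proof (induction i arbitrary: t)
  case (Suc i)
  have "(h i has_real_derivative h (Suc i) t) (at t within {a..b})" using hS Suc by auto
  then have "(nth_deriv_on {a..b} i g has_real_derivative h (Suc i) t) (at t within {a..b})"
    by (rule has_field_derivative_transform[OF Suc.prems(2), rotated]) (use Suc in auto)
  then show ?case
    using vector_derivative_within_closed_interval[OF ab Suc.prems(2)]
    by (simp add: has_real_derivative_iff_has_vector_derivative)
qed (use h0 in auto)

lemma Ck_onI:
  assumes ab: "a < b"
    and h0: "\<And>t. t \<in> {a..b} \<Longrightarrow> g t = h 0 t"
    and hS: "\<And>i t. i < k \<Longrightarrow> t \<in> {a..b} \<Longrightarrow>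
      (h i has_real_derivative h (Suc i) t) (at t within {a..b})"
    and cont: "continuous_on {a..b} (h k)"
  shows "Ck_on k {a..b} g"
  unfolding Ck_on_def
proof (intro conjI allI impI)
  have u: "nth_deriv_on {a..b} i g t = h i t" if "i \<le> k" "t \<in> {a..b}" for i t
    by (rule nth_deriv_on_unique[where g = g and h = h, OF ab h0 hS that])
  show "continuous_on {a..b} (nth_deriv_on {a..b} k g)"
    using cont by (rule continuous_on_eq) (simp add: u)
  fix i assume i: "i < k"
  show "nth_deriv_on {a..b} i g differentiable_on {a..b}"
    unfolding differentiable_on_def
  proof
    fix t assume t: "t \<in> {a..b}"
    have "(nth_deriv_on {a..b} i g has_real_derivative h (Suc i) t) (at t within {a..b})"
      using hS[OF i t] by (rule has_field_derivative_transform[OF t, rotated]) (use u i in auto)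
    then show "nth_deriv_on {a..b} i g differentiable at t within {a..b}"
      using has_field_derivative_imp_has_derivative differentiable_def by blast
  qed
qed

text \<open>The chain of derivatives of a linear combination is the same linear combination of the chains.\<close>

lemma vec_Ck_on_mult_mat:
  assumes M: "M \<in> carrier_mat m n" and g: "vec_Ck_on k {a..b} n g" and ab: "a < b"
  shows "vec_Ck_on k {a..b} m (\<lambda>t. M *\<^sub>v g t)"
  unfolding vec_Ck_on_def
proof (intro conjI ballI allI impI)
  have gc: "g t \<in> carrier_vec n" if "t \<in> {a..b}" for t using g that unfolding vec_Ck_on_def by auto
  fix i assume i: "i < m"
  define h where "h r t = (\<Sum>l<n. M $$ (i, l) * nth_deriv_on {a..b} r (\<lambda>t. g t $ l) t)" for r t
  have Ck: "Ck_on k {a..b} (\<lambda>t. g t $ l)" if "l < n" for l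
    using g that unfolding vec_Ck_on_def by auto
  note d = Ck_on_derivs[OF Ck ab]
  show "Ck_on k {a..b} (\<lambda>t. (M *\<^sub>v g t) $ i)"
  proof (rule Ck_onI[OF ab])
    show "(M *\<^sub>v g t) $ i = h 0 t" if "t \<in> {a..b}" for t
      unfolding h_def using index_mult_vec_sum[OF M gc[OF that] i] by simp
    show "(h r has_real_derivative h (Suc r) t) (at t within {a..b})" if "r < k" "t \<in> {a..b}" for r t
      unfolding h_def[abs_def] by (intro DERIV_sum DERIV_cmult d) (use that in auto)
    show "continuous_on {a..b} (h k)"
      unfolding h_def[abs_def] by (intro continuous_intros d(2)) auto
  qed
qed (use M g in \<open>auto simp: vec_Ck_on_def\<close>)

lemma vec_Ck_on_vec_last:
  assumes g: "vec_Ck_on k S (n + m) g" and gc: "\<And>t. g t \<in> carrier_vec (n + m)"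
  shows "vec_Ck_on k S m (\<lambda>t. vec_last (g t) m)"
proof -
  have "(\<lambda>t. vec_last (g t) m $ j) = (\<lambda>t. g t $ (n + j))" if "j < m" for j
    using that carrier_vecD[OF gc] unfolding vec_last_def by (auto intro!: ext)
  then show ?thesis using g unfolding vec_Ck_on_def by auto
qed

lemma vec_Ck_on_vec_first:
  assumes g: "vec_Ck_on k S (n + m) g"
  shows "vec_Ck_on k S n (\<lambda>t. vec_first (g t) n)"
  using g unfolding vec_Ck_on_def vec_first_def by auto

lemma vec_Ck_on_C1_derivs:
  assumes g: "vec_Ck_on k {a..b} n g" and ab: "a < b" and i: "i < k"
  shows "C1_with_deriv {a..b} n (vec_nth_deriv_on {a..b} i g) (vec_nth_deriv_on {a..b} (Suc i) g)"
proof (rule C1_with_derivI)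
  have gc: "dim_vec (g t) = n" if "t \<in> {a..b}" for t using g that unfolding vec_Ck_on_def by auto
  show "vec_nth_deriv_on {a..b} i g t \<in> carrier_vec n"
    "vec_nth_deriv_on {a..b} (Suc i) g t \<in> carrier_vec n" if "t \<in> {a..b}" for t
    unfolding vec_nth_deriv_on_def using gc[OF that] by auto
  fix j assume j: "j < n"
  have ix: "vec_nth_deriv_on {a..b} r g t $ j = nth_deriv_on {a..b} r (\<lambda>s. g s $ j) t"
    if "t \<in> {a..b}" for r t
    unfolding vec_nth_deriv_on_def using gc[OF that] j by auto
  have "Ck_on k {a..b} (\<lambda>t. g t $ j)" using g j unfolding vec_Ck_on_def by auto
  note d = Ck_on_derivs[OF this ab]
  show "continuous_on {a..b} (\<lambda>t. vec_nth_deriv_on {a..b} (Suc i) g t $ j)"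
    using d(2)[of "Suc i"] i by (rule_tac continuous_on_eq) (auto simp: ix simp del: nth_deriv_on.simps)
  fix t assume t: "t \<in> {a..b}"
  show "((\<lambda>s. vec_nth_deriv_on {a..b} i g s $ j) has_real_derivative
      vec_nth_deriv_on {a..b} (Suc i) g t $ j) (at t within {a..b})"
    unfolding ix[OF t] using d(1)[OF i t]
    by (rule has_field_derivative_transform[OF t, rotated]) (simp add: ix)
qed

lemma C1_with_deriv_imp_vec_Ck_on:
  assumes C1: "C1_with_deriv {a..b} n g g'" and ab: "a < b"
  shows "vec_Ck_on 1 {a..b} n g" "\<And>t. t \<in> {a..b} \<Longrightarrow> vec_nth_deriv_on {a..b} 1 g t = g' t"
proof -
  note c = C1_with_derivD[OF C1]
  define h where "h j r t = (if r = 0 then g t $ j else g' t $ j)" for j t and r :: nat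
  have hS: "(h j r has_real_derivative h j (Suc r) t) (at t within {a..b})"
    if "r < 1" "t \<in> {a..b}" "j < n" for r t j
    using c(3)[OF that(3,2)] that(1) unfolding h_def by simp
  show "vec_Ck_on 1 {a..b} n g" unfolding vec_Ck_on_def
  proof (intro conjI ballI allI impI)
    fix j assume j: "j < n"
    show "Ck_on 1 {a..b} (\<lambda>t. g t $ j)"
      by (rule Ck_onI[where h = "h j", OF ab _ hS[OF _ _ j]]) (use c(4)[OF j] in \<open>auto simp: h_def\<close>)
  qed (use c in auto)
  fix t assume t: "t \<in> {a..b}"
  show "vec_nth_deriv_on {a..b} 1 g t = g' t"
  proof (rule eq_vecI)
    fix j assume "j < dim_vec (g' t)"
    then have j: "j < n" using c(2)[OF t] by auto
    have "nth_deriv_on {a..b} 1 (\<lambda>s. g s $ j) t = h j 1 t"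
      by (rule nth_deriv_on_unique[where h = "h j" and k = 1, OF ab _ hS _ t])
        (use j in \<open>auto simp: h_def\<close>)
    then show "vec_nth_deriv_on {a..b} 1 g t $ j = g' t $ j"
      unfolding vec_nth_deriv_on_def using c(1)[OF t] j by (auto simp: h_def)
  qed (use c(1,2)[OF t] in \<open>auto simp: vec_nth_deriv_on_def\<close>)
qed

lemma vec_nth_deriv_on_0: "vec_nth_deriv_on S 0 g t = g t"
  by (auto simp: vec_nth_deriv_on_def intro!: eq_vecI)

text \<open>Trades the iterated derivative in the definition of a solution for an existentially quantified one.\<close>

lemma bvp_solution_iff_C1:
  assumes T: "0 < T"
  shows "bvp_solution n T E A f B C d x \<longleftrightarrow> (\<exists>x'. C1_with_deriv {0..T} n x x' \<and>
    (\<forall>t\<in>{0<..<T}. E *\<^sub>v x' t = A *\<^sub>v x t + f t) \<and> B *\<^sub>v x 0 + C *\<^sub>v x T = d)"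
    (is "?L \<longleftrightarrow> ?R")
proof
  assume ?L
  then have *: "vec_Ck_on 1 {0..T} n x" unfolding bvp_solution_def by auto
  have "C1_with_deriv {0..T} n x (vec_nth_deriv_on {0..T} 1 x)"
    using vec_Ck_on_C1_derivs[OF * T, of 0] by (simp add: vec_nth_deriv_on_0[abs_def])
  then show ?R using \<open>?L\<close> unfolding bvp_solution_def by blast
next
  assume ?R
  then obtain x' where x': "C1_with_deriv {0..T} n x x'"
    "\<forall>t\<in>{0<..<T}. E *\<^sub>v x' t = A *\<^sub>v x t + f t" "B *\<^sub>v x 0 + C *\<^sub>v x T = d" by auto
  show ?L unfolding bvp_solution_def
    using C1_with_deriv_imp_vec_Ck_on[OF x'(1) T] x'(2,3) by simp
qed

section \<open>The matrix exponential and linear differential equations\<close>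

lemma pow_mat_entry_bound:
  fixes M :: "real mat"
  assumes M: "M \<in> carrier_mat n n"
  obtains c where "\<And>k i j. i < n \<Longrightarrow> j < n \<Longrightarrow> \<bar>(M ^\<^sub>m k) $$ (i, j)\<bar> \<le> c ^ k"
proof
  \<comment> \<open>Any bound of all absolute column sums would do.\<close>
  define c where "c = (\<Sum>j<n. \<Sum>l<n. \<bar>M $$ (l, j)\<bar>)"
  have c0: "0 \<le> c" unfolding c_def by (intro sum_nonneg) auto
  have col: "(\<Sum>l<n. \<bar>M $$ (l, j)\<bar>) \<le> c" if "j < n" for j
    unfolding c_def by (rule member_le_sum[of j]) (use that in \<open>auto intro: sum_nonneg\<close>)
  fix k i j assume ij: "i < n" "j < n"
  show "\<bar>(M ^\<^sub>m k) $$ (i, j)\<bar> \<le> c ^ k" using ij(2)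
  proof (induction k arbitrary: j)
    case 0
    then show ?case using M ij by auto
  next
    case (Suc k)
    have "\<bar>(M ^\<^sub>m Suc k) $$ (i, j)\<bar> = \<bar>\<Sum>l<n. (M ^\<^sub>m k) $$ (i, l) * M $$ (l, j)\<bar>"
      using index_mult_mat_sum[OF pow_carrier_mat[OF M, of k] M ij(1) Suc.prems] by simp
    also have "\<dots> \<le> (\<Sum>l<n. \<bar>(M ^\<^sub>m k) $$ (i, l)\<bar> * \<bar>M $$ (l, j)\<bar>)"
      unfolding abs_mult[symmetric] by (rule sum_abs)
    also have "\<dots> \<le> (\<Sum>l<n. c ^ k * \<bar>M $$ (l, j)\<bar>)"
      by (intro sum_mono mult_right_mono Suc.IH) auto
    also have "\<dots> = c ^ k * (\<Sum>l<n. \<bar>M $$ (l, j)\<bar>)" by (simp add: sum_distrib_left)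
    also have "\<dots> \<le> c ^ k * c" by (intro mult_left_mono col Suc.prems zero_le_power c0)
    finally show ?case by (simp add: mult.commute)
  qed
qed

text \<open>Each entry of \<open>e\<^bsup>tM\<^esup>\<close> is a scalar power series in \<open>t\<close>, dominated by that of an exponential function.\<close>

lemma summable_mat_exp_entry:
  fixes M :: "real mat"
  assumes M: "M \<in> carrier_mat n n" and ij: "i < n" "j < n"
  shows "summable (\<lambda>k. (M ^\<^sub>m k) $$ (i, j) / fact k * t ^ k)"
proof -
  obtain c where c: "\<And>k i j. i < n \<Longrightarrow> j < n \<Longrightarrow> \<bar>(M ^\<^sub>m k) $$ (i, j)\<bar> \<le> c ^ k"
    using pow_mat_entry_bound[OF M] by blast
  show ?thesis
  proof (rule summable_comparison_test'[where N = 0])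
    show "summable (\<lambda>k. inverse (fact k) * (c * \<bar>t\<bar>) ^ k)" by (rule summable_exp)
    fix k :: nat
    show "norm ((M ^\<^sub>m k) $$ (i, j) / fact k * t ^ k) \<le> inverse (fact k) * (c * \<bar>t\<bar>) ^ k"
      using mult_right_mono[OF c[OF ij, of k], of "\<bar>t\<bar> ^ k"]
      by (simp add: abs_mult power_abs power_mult_distrib field_simps)
  qed
qed

lemma mat_exp_carrier:
  "M \<in> carrier_mat n n \<Longrightarrow> mat_exp (t \<cdot>\<^sub>m M) \<in> carrier_mat n n"
  unfolding mat_exp_def by auto

lemma mat_exp_entry:
  assumes M: "M \<in> carrier_mat n n" and ij: "i < n" "j < n"
  shows "mat_exp (t \<cdot>\<^sub>m M) $$ (i, j) = (\<Sum>k. (M ^\<^sub>m k) $$ (i, j) / fact k * t ^ k)"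
proof -
  have "((t \<cdot>\<^sub>m M) ^\<^sub>m k) $$ (i, j) = t ^ k * (M ^\<^sub>m k) $$ (i, j)" for k
    unfolding pow_smult_mat[OF M] using carrier_matD[OF pow_carrier_mat[OF M, of k]] ij by simp
  then show ?thesis unfolding mat_exp_def using M ij by (simp add: ac_simps)
qed

lemma mat_exp_zero:
  assumes M: "M \<in> carrier_mat n n"
  shows "mat_exp (0 \<cdot>\<^sub>m M) = 1\<^sub>m n"
proof (rule eq_matI)
  fix i j assume "i < dim_row (1\<^sub>m n :: real mat)" "j < dim_col (1\<^sub>m n :: real mat)"
  then have ij: "i < n" "j < n" by auto
  have "(\<Sum>k. (M ^\<^sub>m k) $$ (i, j) / fact k * 0 ^ k) = (M ^\<^sub>m 0) $$ (i, j)"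
    using powser_zero[of "\<lambda>k. (M ^\<^sub>m k) $$ (i, j) / fact k"] by simp
  then show "mat_exp (0 \<cdot>\<^sub>m M) $$ (i, j) = 1\<^sub>m n $$ (i, j)"
    unfolding mat_exp_entry[OF M ij] using M by simp
qed (use mat_exp_carrier[OF M, of 0] in auto)

lemma mat_exp_commute:
  assumes M: "M \<in> carrier_mat n n"
  shows "mat_exp (t \<cdot>\<^sub>m M) * M = M * mat_exp (t \<cdot>\<^sub>m M)"
proof (rule eq_matI)
  note e = mat_exp_carrier[OF M, of t]
  fix i j assume "i < dim_row (M * mat_exp (t \<cdot>\<^sub>m M))" "j < dim_col (M * mat_exp (t \<cdot>\<^sub>m M))"
  then have ij: "i < n" "j < n" using M e by auto
  note s = summable_mat_exp_entry[OF M, where t = t]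
  have "(mat_exp (t \<cdot>\<^sub>m M) * M) $$ (i, j) =
      (\<Sum>l<n. (\<Sum>k. (M ^\<^sub>m k) $$ (i, l) / fact k * t ^ k) * M $$ (l, j))"
    using index_mult_mat_sum[OF e M ij] mat_exp_entry[OF M ij(1)] by simp
  also have "\<dots> = (\<Sum>l<n. \<Sum>k. (M ^\<^sub>m k) $$ (i, l) / fact k * t ^ k * M $$ (l, j))"
    using suminf_mult2[OF s[OF ij(1)]] by simp
  also have "\<dots> = (\<Sum>k. \<Sum>l<n. (M ^\<^sub>m k) $$ (i, l) / fact k * t ^ k * M $$ (l, j))"
    by (rule suminf_sum[symmetric]) (intro summable_mult2 s[OF ij(1)], simp)
  also have "\<dots> = (\<Sum>k. (M ^\<^sub>m k * M) $$ (i, j) / fact k * t ^ k)"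
    using index_mult_mat_sum[OF pow_carrier_mat[OF M] M ij]
    by (simp add: sum_distrib_left sum_distrib_right sum_divide_distrib ac_simps)
  also have "\<dots> = (\<Sum>k. (M * M ^\<^sub>m k) $$ (i, j) / fact k * t ^ k)"
    using pow_mat_Suc_left[OF M] by simp
  also have "\<dots> = (\<Sum>k. \<Sum>l<n. M $$ (i, l) * ((M ^\<^sub>m k) $$ (l, j) / fact k * t ^ k))"
    using index_mult_mat_sum[OF M pow_carrier_mat[OF M] ij]
    by (simp add: sum_distrib_left sum_distrib_right sum_divide_distrib ac_simps)
  also have "\<dots> = (\<Sum>l<n. \<Sum>k. M $$ (i, l) * ((M ^\<^sub>m k) $$ (l, j) / fact k * t ^ k))"
    by (rule suminf_sum) (intro summable_mult s[OF _ ij(2)], simp)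
  also have "\<dots> = (\<Sum>l<n. M $$ (i, l) * (\<Sum>k. (M ^\<^sub>m k) $$ (l, j) / fact k * t ^ k))"
    using suminf_mult[OF s[OF _ ij(2)]] by simp
  also have "\<dots> = (M * mat_exp (t \<cdot>\<^sub>m M)) $$ (i, j)"
    using index_mult_mat_sum[OF M e ij] mat_exp_entry[OF M _ ij(2)] by simp
  finally show "(mat_exp (t \<cdot>\<^sub>m M) * M) $$ (i, j) = (M * mat_exp (t \<cdot>\<^sub>m M)) $$ (i, j)" .
qed (use M mat_exp_carrier[OF M, of t] in auto)

text \<open>Differentiating the power series of an entry term by term shifts \<open>M\<^sup>k\<close> to \<open>M\<^sup>k M\<close>.\<close>

lemma mat_exp_has_derivative:
  assumes M: "M \<in> carrier_mat n n" and ij: "i < n" "j < n"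
  shows "((\<lambda>t. mat_exp (t \<cdot>\<^sub>m M) $$ (i, j)) has_real_derivative
    (M * mat_exp (t \<cdot>\<^sub>m M)) $$ (i, j)) (at t within S)"
proof -
  note e = mat_exp_carrier[OF M, of t]
  let ?c = "\<lambda>k. (M ^\<^sub>m k) $$ (i, j) / fact k"
  note s = summable_mat_exp_entry[OF M, where t = t]
  have "((\<lambda>t. \<Sum>k. ?c k * t ^ k) has_real_derivative (\<Sum>k. diffs ?c k * t ^ k)) (at t)"
    by (rule termdiffs_strong_converges_everywhere) (rule summable_mat_exp_entry[OF M ij])
  moreover have "diffs ?c k * t ^ k =
      (\<Sum>l<n. (M ^\<^sub>m k) $$ (i, l) / fact k * t ^ k * M $$ (l, j))" for k
  proof -
    have "diffs ?c k = (M ^\<^sub>m k * M) $$ (i, j) / fact k"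
      unfolding diffs_def by (simp add: field_simps del: of_nat_Suc)
    then show ?thesis using index_mult_mat_sum[OF pow_carrier_mat[OF M] M ij]
      by (simp add: sum_distrib_left sum_distrib_right sum_divide_distrib ac_simps)
  qed
  moreover have "(\<Sum>k. \<Sum>l<n. (M ^\<^sub>m k) $$ (i, l) / fact k * t ^ k * M $$ (l, j)) =
     (\<Sum>l<n. \<Sum>k. (M ^\<^sub>m k) $$ (i, l) / fact k * t ^ k * M $$ (l, j))"
    by (rule suminf_sum) (intro summable_mult2 s[OF ij(1)], simp)
  moreover have "\<dots> = (mat_exp (t \<cdot>\<^sub>m M) * M) $$ (i, j)"
    using index_mult_mat_sum[OF e M ij] mat_exp_entry[OF M ij(1)] suminf_mult2[OF s[OF ij(1)]] by simp
  ultimately have "((\<lambda>t. \<Sum>k. ?c k * t ^ k) has_real_derivative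
      (M * mat_exp (t \<cdot>\<^sub>m M)) $$ (i, j)) (at t)"
    using mat_exp_commute[OF M, of t] by simp
  then show ?thesis unfolding mat_exp_entry[OF M ij] by (rule has_field_derivative_at_within)
qed

lemma continuous_on_mat_exp_entry:
  assumes M: "M \<in> carrier_mat n n" and ij: "i < n" "j < n"
    and h: "continuous_on S h"
  shows "continuous_on S (\<lambda>s. mat_exp (h s \<cdot>\<^sub>m M) $$ (i, j))"
proof -
  have "continuous_on UNIV (\<lambda>t. mat_exp (t \<cdot>\<^sub>m M) $$ (i, j))"
    by (rule DERIV_continuous_on) (rule mat_exp_has_derivative[OF M ij])
  then show ?thesis using h
    by (rule continuous_on_compose2[where g = "\<lambda>t. mat_exp (t \<cdot>\<^sub>m M) $$ (i, j)"]) auto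
qed

text \<open>The function \<open>e\<^bsup>(b-t)M\<^esup> z(t)\<close> has derivative \<open>-M e\<^bsup>(b-t)M\<^esup> z(t) + e\<^bsup>(b-t)M\<^esup> M z(t) = 0\<close>, so its values at \<open>a\<close>
  and \<open>b\<close> agree.\<close>

lemma linear_ode_solution:
  assumes M: "M \<in> carrier_mat n n" and ab: "a \<le> b"
    and z: "\<And>t. t \<in> {a..b} \<Longrightarrow> z t \<in> carrier_vec n"
    and cont: "\<And>i. i < n \<Longrightarrow> continuous_on {a..b} (\<lambda>t. z t $ i)"
    and deriv: "\<And>i t. i < n \<Longrightarrow> t \<in> {a<..<b} \<Longrightarrow>
      ((\<lambda>t. z t $ i) has_real_derivative (M *\<^sub>v z t) $ i) (at t)"
  shows "z b = mat_exp ((b - a) \<cdot>\<^sub>m M) *\<^sub>v z a"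
proof (rule eq_vecI)
  note e = mat_exp_carrier[OF M]
  fix i assume "i < dim_vec (mat_exp ((b - a) \<cdot>\<^sub>m M) *\<^sub>v z a)"
  then have i: "i < n" using e[of "b - a"] by auto
  define w where "w t = (\<Sum>j<n. mat_exp ((b - t) \<cdot>\<^sub>m M) $$ (i, j) * z t $ j)" for t
  have w: "(mat_exp ((b - t) \<cdot>\<^sub>m M) *\<^sub>v z t) $ i = w t" if "t \<in> {a..b}" for t
    unfolding w_def by (rule index_mult_vec_sum[OF e z[OF that] i])
  have "w b = w a"
  proof (cases "a < b")
    case True
    show ?thesis
    proof (rule DERIV_isconst_end[OF True])
      show "continuous_on {a..b} w" unfolding w_def[abs_def]
        by (intro continuous_intros continuous_on_mat_exp_entry[OF M i] cont) auto
      fix t assume "a < t" "t < b"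
      then have t: "t \<in> {a<..<b}" by auto
      then have zt: "z t \<in> carrier_vec n" using z by auto
      let ?e = "mat_exp ((b - t) \<cdot>\<^sub>m M)"
      have de: "((\<lambda>t. mat_exp ((b - t) \<cdot>\<^sub>m M) $$ (i, j)) has_real_derivative
          (M * ?e) $$ (i, j) * (- 1)) (at t)" if "j < n" for j
        by (rule DERIV_chain2[OF mat_exp_has_derivative[OF M i that]])
          (auto intro!: derivative_eq_intros)
      have "(w has_real_derivative (\<Sum>j<n. (M * ?e) $$ (i, j) * (- 1) * z t $ j +
          (M *\<^sub>v z t) $ j * ?e $$ (i, j))) (at t)"
        unfolding w_def[abs_def] by (intro DERIV_sum DERIV_mult de deriv t) auto
      moreover have "(\<Sum>j<n. (M * ?e) $$ (i, j) * (- 1) * z t $ j + (M *\<^sub>v z t) $ j * ?e $$ (i, j)) =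
          (?e *\<^sub>v (M *\<^sub>v z t)) $ i - ((M * ?e) *\<^sub>v z t) $ i"
        using index_mult_vec_sum[OF e mult_mat_vec_carrier[OF M zt] i, of "b - t"]
          index_mult_vec_sum[OF mult_carrier_mat[OF M e] zt i, of "b - t"]
        by (simp add: sum.distrib sum_subtractf sum_negf mult.commute)
      moreover have "?e *\<^sub>v (M *\<^sub>v z t) = (M * ?e) *\<^sub>v z t"
        using assoc_mult_mat_vec[OF e M zt] mat_exp_commute[OF M] by simp
      ultimately show "(w has_real_derivative 0) (at t)" by simp
    qed
  qed (use ab in auto)
  moreover have "w b = z b $ i"
    using w[of b] z[of b] ab mat_exp_zero[OF M] by simp
  ultimately show "z b $ i = (mat_exp ((b - a) \<cdot>\<^sub>m M) *\<^sub>v z a) $ i"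
    using w[of a] ab by simp
qed (use z[of b] ab mat_exp_carrier[OF M, of "b - a"] in auto)

lemma C1_linear_ode_solution:
  assumes M: "M \<in> carrier_mat n n" and T: "0 < T"
    and C1: "C1_with_deriv {0..T} n z z'"
    and ode: "\<And>t. t \<in> {0<..<T} \<Longrightarrow> z' t = M *\<^sub>v z t"
    and t: "t \<in> {0..T}"
  shows "z t = mat_exp (t \<cdot>\<^sub>m M) *\<^sub>v z 0"
proof -
  note c = C1_with_derivD[OF C1]
  have "z t = mat_exp ((t - 0) \<cdot>\<^sub>m M) *\<^sub>v z 0"
  proof (rule linear_ode_solution[OF M])
    show "continuous_on {0..t} (\<lambda>t. z t $ i)" if "i < n" for i
      by (rule continuous_on_subset[OF c(5)[OF that]]) (use t in auto)
    fix i s assume i: "i < n" and s: "s \<in> {0<..<t}"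
    then have "s \<in> {0..T}" "at s within {0..T} = at s"
      using t by (auto intro!: at_within_Icc_at)
    then show "((\<lambda>t. z t $ i) has_real_derivative (M *\<^sub>v z s) $ i) (at s)"
      using c(3)[OF i, of s] ode[of s] s t by auto
  qed (use c t in auto)
  then show ?thesis by simp
qed

text \<open>Each column of \<open>e\<^bsup>(r-s)M\<^esup>\<close>, as a function of \<open>r\<close>, solves the homogeneous equation and is therefore transported from
  \<open>r = 0\<close> to \<open>r = t\<close> by \<open>e\<^bsup>tM\<^esup>\<close>.\<close>

lemma mat_exp_diff:
  assumes M: "M \<in> carrier_mat n n" and t: "0 \<le> t"
  shows "mat_exp ((t - s) \<cdot>\<^sub>m M) = mat_exp (t \<cdot>\<^sub>m M) * mat_exp ((- s) \<cdot>\<^sub>m M)"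
proof (rule eq_matI)
  note e = mat_exp_carrier[OF M]
  fix i j assume "i < dim_row (mat_exp (t \<cdot>\<^sub>m M) * mat_exp ((- s) \<cdot>\<^sub>m M))"
    "j < dim_col (mat_exp (t \<cdot>\<^sub>m M) * mat_exp ((- s) \<cdot>\<^sub>m M))"
  then have ij: "i < n" "j < n" using e[of t] e[of "- s"] by auto
  define z where "z r = col (mat_exp ((r - s) \<cdot>\<^sub>m M)) j" for r
  have zc: "z r \<in> carrier_vec n" for r
    unfolding z_def using e[of "r - s"] col_dim by auto
  have zi: "z r $ l = mat_exp ((r - s) \<cdot>\<^sub>m M) $$ (l, j)" if "l < n" for r l
    unfolding z_def using that ij e[of "r - s"] by auto
  have "z t = mat_exp ((t - 0) \<cdot>\<^sub>m M) *\<^sub>v z 0"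
  proof (rule linear_ode_solution[OF M t zc])
    show "continuous_on {0..t} (\<lambda>t. z t $ l)" if "l < n" for l
      unfolding zi[OF that] by (intro continuous_on_mat_exp_entry[OF M that ij(2)] continuous_intros)
    fix l r assume l: "l < n"
    have "((\<lambda>r. mat_exp ((r - s) \<cdot>\<^sub>m M) $$ (l, j)) has_real_derivative
        (M * mat_exp ((r - s) \<cdot>\<^sub>m M)) $$ (l, j) * 1) (at r)"
      by (rule DERIV_chain2[OF mat_exp_has_derivative[OF M l ij(2)]])
        (auto intro!: derivative_eq_intros)
    moreover have "(M * mat_exp ((r - s) \<cdot>\<^sub>m M)) $$ (l, j) = (M *\<^sub>v z r) $ l"
      unfolding z_def using M e[of "r - s"] l ij by auto
    ultimately show "((\<lambda>t. z t $ l) has_real_derivative (M *\<^sub>v z r) $ l) (at r)"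
      unfolding zi[OF l] by simp
  qed
  then have "z t $ i = (mat_exp (t \<cdot>\<^sub>m M) *\<^sub>v z 0) $ i" by simp
  then show "mat_exp ((t - s) \<cdot>\<^sub>m M) $$ (i, j) =
      (mat_exp (t \<cdot>\<^sub>m M) * mat_exp ((- s) \<cdot>\<^sub>m M)) $$ (i, j)"
    unfolding zi[OF ij(1)] unfolding z_def using e[of t] e[of "- s"] ij by simp
qed (use mat_exp_carrier[OF M, of t] mat_exp_carrier[OF M, of "- s"]
    mat_exp_carrier[OF M, of "t - s"] in auto)

text \<open>The integrand depends on \<open>t\<close> only through the factor \<open>e\<^bsup>tM\<^esup>\<close>, which can be taken out of the integral. The product rule
  then gives the two terms of the derivative.\<close>

lemma variation_of_constants:
  assumes M: "M \<in> carrier_mat n n" and T: "0 < T"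
    and g: "\<And>t. t \<in> {0..T} \<Longrightarrow> g t \<in> carrier_vec n"
    and cont: "\<And>i. i < n \<Longrightarrow> continuous_on {0..T} (\<lambda>t. g t $ i)"
  defines "v \<equiv> \<lambda>t. vec_integral n 0 t (\<lambda>s. mat_exp ((t - s) \<cdot>\<^sub>m M) *\<^sub>v g s)"
  shows "C1_with_deriv {0..T} n v (\<lambda>t. M *\<^sub>v v t + g t)" and "v 0 = 0\<^sub>v n"
proof -
  note e = mat_exp_carrier[OF M]
  define h where "h j s = (mat_exp ((- s) \<cdot>\<^sub>m M) *\<^sub>v g s) $ j" for j s
  define w where "w j t = integral {0..t} (h j)" for j t
  have h_cont: "continuous_on {0..T} (h j)" if j: "j < n" for j
  proof (rule continuous_on_eq)
    show "continuous_on {0..T} (\<lambda>s. \<Sum>l<n. mat_exp ((- s) \<cdot>\<^sub>m M) $$ (j, l) * g s $ l)"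
      by (intro continuous_intros continuous_on_mat_exp_entry[OF M j] cont) auto
  qed (use index_mult_vec_sum[OF e g j] in \<open>simp add: h_def\<close>)
  have h_int: "h j integrable_on {0..t}" if "j < n" "t \<in> {0..T}" for j t
    by (rule integrable_continuous_interval[OF continuous_on_subset[OF h_cont[OF that(1)]]])
      (use that in auto)
  have dw: "(w j has_real_derivative h j t) (at t within {0..T})" if "j < n" "t \<in> {0..T}" for j t
    unfolding w_def[abs_def] by (rule integral_has_real_derivative[OF h_cont[OF that(1)] that(2)])
  have v_entry: "v t $ i = (\<Sum>j<n. mat_exp (t \<cdot>\<^sub>m M) $$ (i, j) * w j t)"
    if i: "i < n" and t: "t \<in> {0..T}" for i t
  proof -
    have "v t $ i = integral {0..t} (\<lambda>s. (mat_exp ((t - s) \<cdot>\<^sub>m M) *\<^sub>v g s) $ i)"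
      unfolding v_def vec_integral_def using i by simp
    also have "\<dots> = integral {0..t} (\<lambda>s. \<Sum>j<n. mat_exp (t \<cdot>\<^sub>m M) $$ (i, j) * h j s)"
    proof (rule Henstock_Kurzweil_Integration.integral_cong)
      fix s assume "s \<in> {0..t}"
      then have gs: "g s \<in> carrier_vec n" using t g by auto
      have "mat_exp ((t - s) \<cdot>\<^sub>m M) *\<^sub>v g s = mat_exp (t \<cdot>\<^sub>m M) *\<^sub>v (mat_exp ((- s) \<cdot>\<^sub>m M) *\<^sub>v g s)"
        using mat_exp_diff[OF M, of t s] t assoc_mult_mat_vec[OF e e gs] by simp
      then show "(mat_exp ((t - s) \<cdot>\<^sub>m M) *\<^sub>v g s) $ i =
          (\<Sum>j<n. mat_exp (t \<cdot>\<^sub>m M) $$ (i, j) * h j s)"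
        unfolding h_def using index_mult_vec_sum[OF e mult_mat_vec_carrier[OF e gs] i] by simp
    qed
    also have "\<dots> = (\<Sum>j<n. integral {0..t} (\<lambda>s. mat_exp (t \<cdot>\<^sub>m M) $$ (i, j) * h j s))"
      by (rule integral_sum) (auto intro!: integrable_on_mult_right h_int t simp del: atLeastAtMost_iff)
    also have "\<dots> = (\<Sum>j<n. mat_exp (t \<cdot>\<^sub>m M) $$ (i, j) * w j t)" unfolding w_def by simp
    finally show ?thesis .
  qed
  have vc: "v t \<in> carrier_vec n" for t unfolding v_def vec_integral_def by auto
  define W where "W t = vec n (\<lambda>j. w j t)" for t
  have Wc: "W t \<in> carrier_vec n" for t unfolding W_def by auto
  have vW: "v t = mat_exp (t \<cdot>\<^sub>m M) *\<^sub>v W t" if t: "t \<in> {0..T}" for t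
  proof (rule eq_vecI)
    fix i assume "i < dim_vec (mat_exp (t \<cdot>\<^sub>m M) *\<^sub>v W t)"
    then have i: "i < n" using e[of t] by auto
    show "v t $ i = (mat_exp (t \<cdot>\<^sub>m M) *\<^sub>v W t) $ i"
      unfolding v_entry[OF i t] index_mult_vec_sum[OF e Wc i] by (simp add: W_def)
  qed (use vc[of t] e[of t] in auto)
  have deriv: "((\<lambda>t. v t $ i) has_real_derivative (M *\<^sub>v v t + g t) $ i) (at t within {0..T})"
    if i: "i < n" and t: "t \<in> {0..T}" for i t
  proof -
    note gt = g[OF t]
    let ?e = "mat_exp (t \<cdot>\<^sub>m M)" and ?hv = "mat_exp ((- t) \<cdot>\<^sub>m M) *\<^sub>v g t"
    have "((\<lambda>t. \<Sum>j<n. mat_exp (t \<cdot>\<^sub>m M) $$ (i, j) * w j t) has_real_derivative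
        (\<Sum>j<n. (M * ?e) $$ (i, j) * w j t + h j t * ?e $$ (i, j))) (at t within {0..T})"
      by (intro DERIV_sum DERIV_mult mat_exp_has_derivative[OF M i] dw t) auto
    moreover have "(\<Sum>j<n. (M * ?e) $$ (i, j) * w j t + h j t * ?e $$ (i, j)) =
        ((M * ?e) *\<^sub>v W t) $ i + (?e *\<^sub>v ?hv) $ i"
      using index_mult_vec_sum[OF mult_carrier_mat[OF M e] Wc i, of t t]
        index_mult_vec_sum[OF e mult_mat_vec_carrier[OF e gt] i, of t "- t"]
      by (simp add: sum.distrib W_def h_def ac_simps)
    moreover have "(M * ?e) *\<^sub>v W t = M *\<^sub>v v t"
      unfolding vW[OF t] by (rule assoc_mult_mat_vec[OF M e Wc])
    moreover have "?e *\<^sub>v ?hv = g t"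
    proof -
      have "?e * mat_exp ((- t) \<cdot>\<^sub>m M) = 1\<^sub>m n"
        using mat_exp_diff[OF M, of t t] t mat_exp_zero[OF M] by simp
      then show ?thesis using assoc_mult_mat_vec[OF e e gt, of t "- t"] gt by simp
    qed
    ultimately have "((\<lambda>t. \<Sum>j<n. mat_exp (t \<cdot>\<^sub>m M) $$ (i, j) * w j t) has_real_derivative
        (M *\<^sub>v v t + g t) $ i) (at t within {0..T})"
      using gt i M by simp
    then show ?thesis
      by (rule has_field_derivative_transform[OF t, rotated]) (rule v_entry[OF i])
  qed
  show "C1_with_deriv {0..T} n v (\<lambda>t. M *\<^sub>v v t + g t)"
  proof (rule C1_with_derivI[OF vc])
    fix i assume i: "i < n"
    have "continuous_on {0..T} (\<lambda>t. v t $ j)" if "j < n" for j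
      by (rule DERIV_continuous_on) (rule deriv[OF that])
    then have "continuous_on {0..T} (\<lambda>t. (\<Sum>l<n. M $$ (i, l) * v t $ l) + g t $ i)"
      by (intro continuous_intros cont i) auto
    then show "continuous_on {0..T} (\<lambda>t. (M *\<^sub>v v t + g t) $ i)"
    proof (rule continuous_on_eq)
      fix t assume "t \<in> {0..T}"
      then show "(\<Sum>l<n. M $$ (i, l) * v t $ l) + g t $ i = (M *\<^sub>v v t + g t) $ i"
        using index_mult_vec_sum[OF M vc i, of t] g[of t] i M by simp
    qed
  qed (use deriv g M vc in auto)
  show "v 0 = 0\<^sub>v n" unfolding v_def vec_integral_def by (intro eq_vecI) auto
qed

lemma mat_integral_mult_vec:
  assumes G: "\<And>s. G s \<in> carrier_mat n n" and z: "z \<in> carrier_vec n"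
    and cont: "\<And>i j. i < n \<Longrightarrow> j < n \<Longrightarrow> continuous_on {a..b} (\<lambda>s. G s $$ (i, j))"
  shows "mat_integral n a b G *\<^sub>v z = vec_integral n a b (\<lambda>s. G s *\<^sub>v z)"
proof (rule eq_vecI)
  fix i assume "i < dim_vec (vec_integral n a b (\<lambda>s. G s *\<^sub>v z))"
  then have i: "i < n" unfolding vec_integral_def by simp
  have c: "mat_integral n a b G \<in> carrier_mat n n" unfolding mat_integral_def by simp
  have "(mat_integral n a b G *\<^sub>v z) $ i = (\<Sum>l<n. integral {a..b} (\<lambda>s. G s $$ (i, l) * z $ l))"
    unfolding index_mult_vec_sum[OF c z i] using i by (simp add: mat_integral_def)
  also have "\<dots> = integral {a..b} (\<lambda>s. \<Sum>l<n. G s $$ (i, l) * z $ l)"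
    by (rule integral_sum[symmetric])
      (auto intro!: integrable_continuous_interval continuous_intros cont i)
  also have "\<dots> = vec_integral n a b (\<lambda>s. G s *\<^sub>v z) $ i"
    unfolding vec_integral_def using i index_mult_vec_sum[OF G z i] by simp
  finally show "(mat_integral n a b G *\<^sub>v z) $ i = vec_integral n a b (\<lambda>s. G s *\<^sub>v z) $ i" .
qed (auto simp: vec_integral_def mat_integral_def)

lemma vec_integral_add:
  assumes g: "\<And>s. s \<in> {a..b} \<Longrightarrow> g s \<in> carrier_vec n" and h: "\<And>s. s \<in> {a..b} \<Longrightarrow> h s \<in> carrier_vec n"
    and "\<And>i. i < n \<Longrightarrow> continuous_on {a..b} (\<lambda>s. g s $ i)"
    and "\<And>i. i < n \<Longrightarrow> continuous_on {a..b} (\<lambda>s. h s $ i)"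
  shows "vec_integral n a b (\<lambda>s. g s + h s) = vec_integral n a b g + vec_integral n a b h"
proof (rule eq_vecI)
  fix i assume "i < dim_vec (vec_integral n a b g + vec_integral n a b h)"
  then have i: "i < n" unfolding vec_integral_def by simp
  have "integral {a..b} (\<lambda>s. (g s + h s) $ i) = integral {a..b} (\<lambda>s. g s $ i + h s $ i)"
    by (rule Henstock_Kurzweil_Integration.integral_cong) (use g h i in force)
  also have "\<dots> = integral {a..b} (\<lambda>s. g s $ i) + integral {a..b} (\<lambda>s. h s $ i)"
    by (intro Henstock_Kurzweil_Integration.integral_add integrable_continuous_interval assms i)
  finally show "vec_integral n a b (\<lambda>s. g s + h s) $ i = (vec_integral n a b g + vec_integral n a b h) $ i"
    unfolding vec_integral_def using i by simp
qed (auto simp: vec_integral_def)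

text \<open>The exponentials under the integral commute with \<open>M\<close>. This reconciles the order of factors in the matrix
  of the boundary condition with the one in the solution formula.\<close>

lemma mat_integral_exp_commute:
  assumes M: "M \<in> carrier_mat n n"
  shows "M * mat_integral n a b (\<lambda>s. mat_exp ((t - s) \<cdot>\<^sub>m M)) =
    mat_integral n a b (\<lambda>s. mat_exp ((t - s) \<cdot>\<^sub>m M)) * M" (is "M * ?I = ?I * M")
proof (rule eq_matI)
  note e = mat_exp_carrier[OF M]
  have I: "?I \<in> carrier_mat n n" unfolding mat_integral_def by simp
  fix i j assume "i < dim_row (?I * M)" "j < dim_col (?I * M)"
  then have ij: "i < n" "j < n" using I M by auto
  have int: "(\<lambda>s. mat_exp ((t - s) \<cdot>\<^sub>m M) $$ (k, l)) integrable_on {a..b}" if "k < n" "l < n" for k l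
    by (intro integrable_continuous_interval continuous_on_mat_exp_entry[OF M that] continuous_intros)
  have "(M * ?I) $$ (i, j) = (\<Sum>l<n. integral {a..b} (\<lambda>s. M $$ (i, l) * mat_exp ((t - s) \<cdot>\<^sub>m M) $$ (l, j)))"
    unfolding index_mult_mat_sum[OF M I ij] using ij by (simp add: mat_integral_def)
  also have "\<dots> = integral {a..b} (\<lambda>s. \<Sum>l<n. M $$ (i, l) * mat_exp ((t - s) \<cdot>\<^sub>m M) $$ (l, j))"
    by (rule integral_sum[symmetric]) (use int[OF _ ij(2)] in \<open>auto intro: integrable_on_mult_right\<close>)
  also have "\<dots> = integral {a..b} (\<lambda>s. \<Sum>l<n. mat_exp ((t - s) \<cdot>\<^sub>m M) $$ (i, l) * M $$ (l, j))"
    using index_mult_mat_sum[OF M e ij] index_mult_mat_sum[OF e M ij] mat_exp_commute[OF M] by metis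
  also have "\<dots> = (\<Sum>l<n. integral {a..b} (\<lambda>s. mat_exp ((t - s) \<cdot>\<^sub>m M) $$ (i, l) * M $$ (l, j)))"
    by (rule integral_sum) (use int[OF ij(1)] in \<open>auto intro: integrable_on_mult_left\<close>)
  also have "\<dots> = (?I * M) $$ (i, j)"
    unfolding index_mult_mat_sum[OF I M ij] using ij by (simp add: mat_integral_def)
  finally show "(M * ?I) $$ (i, j) = (?I * M) $$ (i, j)" .
qed (use M in \<open>auto simp: mat_integral_def\<close>)

section \<open>The nilpotent subsystem\<close>

lemma mult_mat_vec_finsum:
  fixes M :: "'a :: comm_semiring_0 mat"
  assumes M: "M \<in> carrier_mat m n" and I: "finite I" and v: "\<And>i. i \<in> I \<Longrightarrow> v i \<in> carrier_vec n"
  shows "M *\<^sub>v finsum_vec TYPE('a) n v I = finsum_vec TYPE('a) m (\<lambda>i. M *\<^sub>v v i) I"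
  using I v
proof (induction I)
  case empty
  have "M *\<^sub>v 0\<^sub>v n = 0\<^sub>v m" using M by (intro eq_vecI) auto
  then show ?case by (simp add: finsum_vec_empty)
next
  case (insert i I)
  have c: "v i \<in> carrier_vec n" "v \<in> I \<rightarrow> carrier_vec n" using insert by auto
  then have "M *\<^sub>v v i \<in> carrier_vec m" "(\<lambda>i. M *\<^sub>v v i) \<in> I \<rightarrow> carrier_vec m"
    using M by (auto intro!: mult_mat_vec_carrier)
  then show ?case
    using insert c mult_add_distrib_mat_vec[OF M c(1) finsum_vec_closed[OF c(2)]]
      finsum_vec_insert[OF insert(1,2) c(2,1)] finsum_vec_insert[OF insert(1,2), of "\<lambda>i. M *\<^sub>v v i" m]
    by simp
qed

lemma mult_mat_vec_uminus:
  fixes M :: "'a :: comm_ring_1 mat"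
  assumes "M \<in> carrier_mat m n" "v \<in> carrier_vec n"
  shows "M *\<^sub>v (- v) = - (M *\<^sub>v v)"
  using carrier_matD[OF assms(1)] carrier_vecD[OF assms(2)] by (intro eq_vecI) auto

text \<open>Multiplying \<open>y'\<close> by \<open>N\<close> shifts the sum by one index: the term \<open>F 0\<close> is lost at the lower end,
  and the new term at the upper end contains \<open>N\<^sup>k = 0\<close>. Here \<open>F i\<close> stands for the \<open>i\<close>-th derivative of
  the inhomogeneity.\<close>

lemma nilpotent_dae_solution:
  fixes F :: "nat \<Rightarrow> real \<Rightarrow> real vec"
  assumes N: "N \<in> carrier_mat n n" and nil: "N ^\<^sub>m k = 0\<^sub>m n n"
    and F: "\<And>i. i < k \<Longrightarrow> C1_with_deriv S n (F i) (F (Suc i))"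
    and F0: "\<And>t. t \<in> S \<Longrightarrow> F 0 t \<in> carrier_vec n"
  defines "y \<equiv> \<lambda>t. - finsum_vec TYPE(real) n (\<lambda>i. N ^\<^sub>m i *\<^sub>v F i t) {..<k}"
    and "y' \<equiv> \<lambda>t. - finsum_vec TYPE(real) n (\<lambda>i. N ^\<^sub>m i *\<^sub>v F (Suc i) t) {..<k}"
  shows "C1_with_deriv S n y y'" and "\<And>t. t \<in> S \<Longrightarrow> N *\<^sub>v y' t = y t + F 0 t"
proof -
  note Np = pow_carrier_mat[OF N]
  show "C1_with_deriv S n y y'" unfolding y_def y'_def
    by (intro C1_with_deriv_uminus C1_with_deriv_finsum C1_with_deriv_mult_mat[OF Np] F) auto
  fix t assume t: "t \<in> S"
  have Fc: "F i t \<in> carrier_vec n" if "i \<le> k" for i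
    using that F0[OF t] C1_with_derivD(2)[OF F t] by (cases i) auto
  define a where "a i = N ^\<^sub>m i *\<^sub>v F i t" for i
  have ac: "a i \<in> carrier_vec n" if "i \<le> k" for i
    unfolding a_def by (rule mult_mat_vec_carrier[OF Np Fc[OF that]])
  let ?S = "finsum_vec TYPE(real) n a {..<k}"
  let ?S' = "finsum_vec TYPE(real) n (\<lambda>i. N ^\<^sub>m i *\<^sub>v F (Suc i) t) {..<k}"
  have Sc: "?S \<in> carrier_vec n" by (rule finsum_vec_closed) (use ac in auto)
  have S'c: "?S' \<in> carrier_vec n"
    by (rule finsum_vec_closed) (use Fc in \<open>auto intro!: mult_mat_vec_carrier[OF Np]\<close>)
  have yS: "y t = - ?S" unfolding y_def a_def by simp
  have "N *\<^sub>v y' t = - (N *\<^sub>v ?S')" unfolding y'_def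
    using N S'c by (intro eq_vecI) (auto)
  have "N *\<^sub>v ?S' = finsum_vec TYPE(real) n (\<lambda>i. N *\<^sub>v (N ^\<^sub>m i *\<^sub>v F (Suc i) t)) {..<k}"
    by (rule mult_mat_vec_finsum[OF N]) (use Fc in \<open>auto intro!: mult_mat_vec_carrier[OF Np]\<close>)
  have shift: "N *\<^sub>v (N ^\<^sub>m i *\<^sub>v F (Suc i) t) = a (Suc i)" if "i < k" for i
    unfolding a_def pow_mat_Suc_left[OF N]
    using assoc_mult_mat_vec[OF N Np Fc, of "Suc i" i] that by simp
  have Ny': "(N *\<^sub>v y' t) $ j = - (\<Sum>i<k. a (Suc i) $ j)" if "j < n" for j
  proof -
    let ?NS' = "finsum_vec TYPE(real) n (\<lambda>i. N *\<^sub>v (N ^\<^sub>m i *\<^sub>v F (Suc i) t)) {..<k}"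
    have "?NS' $ j = (\<Sum>i<k. a (Suc i) $ j)"
      using shift ac that by (subst index_finsum_vec) (auto simp: Pi_def)
    moreover have "?NS' \<in> carrier_vec n"
      by (rule finsum_vec_closed) (use shift ac in auto)
    ultimately show ?thesis using that \<open>N *\<^sub>v y' t = - (N *\<^sub>v ?S')\<close> \<open>N *\<^sub>v ?S' = ?NS'\<close> by simp
  qed
  show "N *\<^sub>v y' t = y t + F 0 t"
  proof (rule eq_vecI)
    fix j assume "j < dim_vec (y t + F 0 t)"
    then have j: "j < n" using F0[OF t] by simp
    have "(\<Sum>i<k. a (Suc i) $ j) + a 0 $ j = (\<Sum>i<k. a i $ j) + a k $ j"
      using sum.lessThan_Suc_shift[of "\<lambda>i. a i $ j" k] by simp
    moreover have "a k $ j = 0" unfolding a_def nil using Fc[of k] j by simp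
    moreover have "a 0 = F 0 t" unfolding a_def using N F0[OF t] by simp
    moreover have "?S $ j = (\<Sum>i<k. a i $ j)" by (rule index_finsum_vec) (use ac j in auto)
    ultimately show "(N *\<^sub>v y' t) $ j = (y t + F 0 t) $ j"
      unfolding Ny'[OF j] yS using j Sc F0[OF t] by simp
  qed (use N F0[OF t] in auto)
qed

text \<open>Substituting \<open>z = N z'\<close> into itself would need derivatives of \<open>z\<close> of higher order. The descent goes the other way: if
  \<open>N\<^bsup>m+1\<^esup> z\<close> vanishes on the open interval, so does its derivative \<open>N\<^bsup>m+1\<^esup> z'\<close>, which equals
  \<open>N\<^sup>m z\<close>. Starting from \<open>N\<^sup>k = 0\<close> one reaches \<open>z = 0\<close>; continuity covers the end points.\<close>

lemma homogeneous_nilpotent_dae: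
  assumes N: "N \<in> carrier_mat n n" and nil: "N ^\<^sub>m k = 0\<^sub>m n n" and T: "0 < T"
    and C1: "C1_with_deriv {0..T} n z z'"
    and dae: "\<And>t. t \<in> {0<..<T} \<Longrightarrow> N *\<^sub>v z' t = z t"
    and t: "t \<in> {0..T}"
  shows "z t = 0\<^sub>v n"
proof -
  note c = C1_with_derivD[OF C1] and Np = pow_carrier_mat[OF N]
  have interior: "N ^\<^sub>m (k - l) *\<^sub>v z t = 0\<^sub>v n" if "t \<in> {0<..<T}" for t l
    using that
  proof (induction l arbitrary: t)
    case 0
    then show ?case using nil c(1)[of t] by auto
  next
    case (Suc l)
    show ?case
    proof (cases "l < k")
      case False
      then show ?thesis using Suc by simp
    next
      case True
      define m where "m = k - Suc l"
      have m: "k - l = Suc m" using True unfolding m_def by simp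
      from Suc.prems have tc: "t \<in> {0..T}" by auto
      have "N ^\<^sub>m Suc m *\<^sub>v z' t = 0\<^sub>v n"
      proof (rule eq_vecI)
        fix i assume "i < dim_vec (0\<^sub>v n :: real vec)"
        then have i: "i < n" by simp
        have "((\<lambda>s. (N ^\<^sub>m Suc m *\<^sub>v z s) $ i) has_real_derivative (N ^\<^sub>m Suc m *\<^sub>v z' t) $ i)
            (at t within {0..T})"
          by (rule C1_with_derivD(3)[OF C1_with_deriv_mult_mat[OF Np C1] i tc])
        then have "((\<lambda>s. (N ^\<^sub>m Suc m *\<^sub>v z s) $ i) has_real_derivative (N ^\<^sub>m Suc m *\<^sub>v z' t) $ i) (at t)"
          using Suc.prems by (simp add: at_within_Icc_at)
        moreover have "((\<lambda>s. (N ^\<^sub>m Suc m *\<^sub>v z s) $ i) has_real_derivative 0) (at t)"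
        proof (rule has_field_derivative_transform_within_open[where S = "{0<..<T}"])
          show "((\<lambda>s. 0 :: real) has_real_derivative 0) (at t)" by simp
          show "0 = (N ^\<^sub>m Suc m *\<^sub>v z s) $ i" if "s \<in> {0<..<T}" for s
            using Suc.IH[OF that] i unfolding m by simp
        qed (use Suc.prems in auto)
        ultimately show "(N ^\<^sub>m Suc m *\<^sub>v z' t) $ i = 0\<^sub>v n $ i"
          using i DERIV_unique by fastforce
      qed (use N in auto)
      moreover have "N ^\<^sub>m Suc m *\<^sub>v z' t = N ^\<^sub>m m *\<^sub>v z t"
        using assoc_mult_mat_vec[OF Np N c(2)[OF tc], of m] dae[OF Suc.prems] by simp
      ultimately show ?thesis unfolding m_def by simp
    qed
  qed
  have z0: "z t = 0\<^sub>v n" if "t \<in> {0<..<T}" for t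
    using interior[OF that, of k] c(1)[of t] that N by auto
  show ?thesis
  proof (rule eq_vecI)
    fix i assume "i < dim_vec (0\<^sub>v n :: real vec)"
    then have i: "i < n" by simp
    have "z t $ i = 0"
      by (rule continuous_constant_on_closure[where S = "{0<..<T}" and f = "\<lambda>t. z t $ i"])
        (use T t c(5)[OF i] z0 i in auto)
    then show "z t $ i = 0\<^sub>v n $ i" using i by simp
  qed (use c(1)[OF t] in auto)
qed

section \<open>Decoupling and the boundary condition\<close>

text \<open>Multiplication by \<open>P\<close> is injective and turns the equation into the one for the canonical form.\<close>

lemma weierstrass_decoupling:
  assumes E: "E \<in> carrier_mat n n" and A: "A \<in> carrier_mat n n"
    and W: "weierstrass_form n E A P Q n1 J n2 N"
    and a: "a \<in> carrier_vec n1" "a' \<in> carrier_vec n1"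
    and b: "b \<in> carrier_vec n2" "b' \<in> carrier_vec n2" and h: "h \<in> carrier_vec n"
  shows "E *\<^sub>v (Q *\<^sub>v (a' @\<^sub>v b')) = A *\<^sub>v (Q *\<^sub>v (a @\<^sub>v b)) + h \<longleftrightarrow>
    a' = J *\<^sub>v a + vec_first (P *\<^sub>v h) n1 \<and> N *\<^sub>v b' = b + vec_last (P *\<^sub>v h) n2"
proof -
  note w = W[unfolded weierstrass_form_def]
  have n: "n1 + n2 = n" and P: "P \<in> carrier_mat n n" "invertible_mat P"
    and Q: "Q \<in> carrier_mat n n" and J: "J \<in> carrier_mat n1 n1" and N: "N \<in> carrier_mat n2 n2"
    and PEQ: "P * E * Q = four_block_mat (1\<^sub>m n1) (0\<^sub>m n1 n2) (0\<^sub>m n2 n1) N"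
    and PAQ: "P * A * Q = four_block_mat J (0\<^sub>m n1 n2) (0\<^sub>m n2 n1) (1\<^sub>m n2)"
    using w by auto
  note Pi = inv_mat_props[OF P]
  have cancel: "P *\<^sub>v u = P *\<^sub>v v \<longleftrightarrow> u = v" if "u \<in> carrier_vec n" "v \<in> carrier_vec n" for u v
    using assoc_mult_mat_vec[OF Pi(1) P(1) that(1)] assoc_mult_mat_vec[OF Pi(1) P(1) that(2)]
      Pi(3) that by auto
  have X: "a @\<^sub>v b \<in> carrier_vec n" "a' @\<^sub>v b' \<in> carrier_vec n"
    using append_carrier_vec[OF a(1) b(1)] append_carrier_vec[OF a(2) b(2)] n by auto
  have triple: "P *\<^sub>v (M *\<^sub>v (Q *\<^sub>v v)) = (P * M * Q) *\<^sub>v v"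
    if "M \<in> carrier_mat n n" "v \<in> carrier_vec n" for M v
    using assoc_mult_mat_vec[OF mult_carrier_mat[OF P(1) that(1)] Q that(2)]
      assoc_mult_mat_vec[OF P(1) that(1) mult_mat_vec_carrier[OF Q that(2)]] by simp
  have c: "E *\<^sub>v (Q *\<^sub>v (a' @\<^sub>v b')) \<in> carrier_vec n" "A *\<^sub>v (Q *\<^sub>v (a @\<^sub>v b)) \<in> carrier_vec n"
    using E A Q X by (auto intro!: mult_mat_vec_carrier)
  have Ph: "P *\<^sub>v h = vec_first (P *\<^sub>v h) n1 @\<^sub>v vec_last (P *\<^sub>v h) n2"
    using mult_mat_vec_carrier[OF P(1) h] n by simp
  have "P *\<^sub>v (E *\<^sub>v (Q *\<^sub>v (a' @\<^sub>v b'))) = a' @\<^sub>v (N *\<^sub>v b')"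
    unfolding triple[OF E X(2)] PEQ
    by (subst mult_mat_vec_split) (use N a b in auto)
  moreover have "P *\<^sub>v (A *\<^sub>v (Q *\<^sub>v (a @\<^sub>v b)) + h) =
      (J *\<^sub>v a + vec_first (P *\<^sub>v h) n1) @\<^sub>v (b + vec_last (P *\<^sub>v h) n2)"
  proof -
    have "P *\<^sub>v (A *\<^sub>v (Q *\<^sub>v (a @\<^sub>v b)) + h) = ((J *\<^sub>v a) @\<^sub>v b) + P *\<^sub>v h"
      unfolding mult_add_distrib_mat_vec[OF P(1) c(2) h] triple[OF A X(1)] PAQ
      by (subst mult_mat_vec_split) (use J a b in auto)
    then show ?thesis
      by (subst append_vec_add[symmetric, of _ n1 _ _ n2]) (use J a b Ph in auto)
  qed
  moreover have "a' @\<^sub>v (N *\<^sub>v b') = (J *\<^sub>v a + vec_first (P *\<^sub>v h) n1) @\<^sub>v (b + vec_last (P *\<^sub>v h) n2) \<longleftrightarrow>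
      a' = J *\<^sub>v a + vec_first (P *\<^sub>v h) n1 \<and> N *\<^sub>v b' = b + vec_last (P *\<^sub>v h) n2"
    by (rule append_vec_eq) (use J a in auto)
  ultimately show ?thesis
    using cancel[OF c(1), of "A *\<^sub>v (Q *\<^sub>v (a @\<^sub>v b)) + h"] c h by auto
qed

lemma boundary_block_mult:
  fixes Q :: "'a :: field mat"
  assumes Q: "Q \<in> carrier_mat n n" "invertible_mat Q" and n: "n1 + n2 = n"
    and B1: "B1 \<in> carrier_mat n1 n1" and B2: "B2 \<in> carrier_mat n1 n2"
    and a: "a \<in> carrier_vec n1" and b: "b \<in> carrier_vec n2"
  shows "(four_block_mat B1 B2 (0\<^sub>m n2 n1) (0\<^sub>m n2 n2) * inv_mat Q) *\<^sub>v (Q *\<^sub>v (a @\<^sub>v b)) =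
    (B1 *\<^sub>v a + B2 *\<^sub>v b) @\<^sub>v 0\<^sub>v n2" (is "(?B * _) *\<^sub>v _ = _")
proof -
  note Qi = inv_mat_props[OF Q]
  have Bc: "?B \<in> carrier_mat n n" using B1 B2 n by auto
  have X: "a @\<^sub>v b \<in> carrier_vec n" using append_carrier_vec[OF a b] n by auto
  have "(?B * inv_mat Q) *\<^sub>v (Q *\<^sub>v (a @\<^sub>v b)) = ?B *\<^sub>v ((inv_mat Q * Q) *\<^sub>v (a @\<^sub>v b))"
    using assoc_mult_mat_vec[OF Bc Qi(1) mult_mat_vec_carrier[OF Q(1) X]]
      assoc_mult_mat_vec[OF Qi(1) Q(1) X] by simp
  also have "\<dots> = ?B *\<^sub>v (a @\<^sub>v b)" using Qi(3) X by simp
  also have "\<dots> = (B1 *\<^sub>v a + B2 *\<^sub>v b) @\<^sub>v 0\<^sub>v n2"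
    by (subst four_block_mat_mult_vec[OF B1 B2 _ _ a b]) (use a b in auto)
  finally show ?thesis .
qed

text \<open>The deviation \<open>u\<close> of the solution from its initial value \<open>z\<close> starts at \<open>0\<close> and solves
  \<open>u' = J u + (J z + g)\<close>. So variation of constants applies with the inhomogeneity \<open>J z + g\<close>.\<close>

lemma forced_linear_ode_solution:
  assumes J: "J \<in> carrier_mat n n" and T: "0 < T" and z: "z \<in> carrier_vec n"
    and g: "\<And>t. t \<in> {0..T} \<Longrightarrow> g t \<in> carrier_vec n"
    and cont: "\<And>i. i < n \<Longrightarrow> continuous_on {0..T} (\<lambda>t. g t $ i)"
  defines "u \<equiv> \<lambda>t. mat_integral n 0 t (\<lambda>s. mat_exp ((t - s) \<cdot>\<^sub>m J)) *\<^sub>v (J *\<^sub>v z)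
      + vec_integral n 0 t (\<lambda>s. mat_exp ((t - s) \<cdot>\<^sub>m J) *\<^sub>v g s)"
  shows "C1_with_deriv {0..T} n (\<lambda>t. z + u t) (\<lambda>t. J *\<^sub>v (z + u t) + g t)" and "u 0 = 0\<^sub>v n"
proof -
  note e = mat_exp_carrier[OF J]
  have Jz: "J *\<^sub>v z \<in> carrier_vec n" using J z by (rule mult_mat_vec_carrier)
  have u_eq: "u t = vec_integral n 0 t (\<lambda>s. mat_exp ((t - s) \<cdot>\<^sub>m J) *\<^sub>v (J *\<^sub>v z + g s))"
    if t: "t \<in> {0..T}" for t
  proof -
    have e_cont: "continuous_on {0..t} (\<lambda>s. mat_exp ((t - s) \<cdot>\<^sub>m J) $$ (i, j))"
      if "i < n" "j < n" for i j
      by (intro continuous_on_mat_exp_entry[OF J that] continuous_intros)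
    have eh_cont: "continuous_on {0..t} (\<lambda>s. (mat_exp ((t - s) \<cdot>\<^sub>m J) *\<^sub>v h s) $ i)"
      if i: "i < n" and h: "\<And>s. s \<in> {0..t} \<Longrightarrow> h s \<in> carrier_vec n"
        and hc: "\<And>j. j < n \<Longrightarrow> continuous_on {0..t} (\<lambda>s. h s $ j)" for h i
    proof (rule continuous_on_eq)
      show "continuous_on {0..t} (\<lambda>s. \<Sum>l<n. mat_exp ((t - s) \<cdot>\<^sub>m J) $$ (i, l) * h s $ l)"
        by (intro continuous_intros e_cont hc i) auto
    qed (use index_mult_vec_sum[OF e h i] in simp)
    have gt: "g s \<in> carrier_vec n" if "s \<in> {0..t}" for s using that t g by auto
    have gct: "continuous_on {0..t} (\<lambda>s. g s $ i)" if "i < n" for i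
      by (rule continuous_on_subset[OF cont[OF that]]) (use t in auto)
    have "u t = vec_integral n 0 t (\<lambda>s. mat_exp ((t - s) \<cdot>\<^sub>m J) *\<^sub>v (J *\<^sub>v z))
      + vec_integral n 0 t (\<lambda>s. mat_exp ((t - s) \<cdot>\<^sub>m J) *\<^sub>v g s)"
      unfolding u_def by (subst mat_integral_mult_vec[OF e Jz e_cont]) auto
    also have "\<dots> = vec_integral n 0 t (\<lambda>s. mat_exp ((t - s) \<cdot>\<^sub>m J) *\<^sub>v (J *\<^sub>v z)
      + mat_exp ((t - s) \<cdot>\<^sub>m J) *\<^sub>v g s)"
      by (rule vec_integral_add[symmetric])
        (use Jz gt gct in \<open>auto intro!: mult_mat_vec_carrier[OF e] eh_cont\<close>)
    also have "\<dots> = vec_integral n 0 t (\<lambda>s. mat_exp ((t - s) \<cdot>\<^sub>m J) *\<^sub>v (J *\<^sub>v z + g s))"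
      unfolding vec_integral_def
      by (intro eq_vecI)
        (auto intro!: Henstock_Kurzweil_Integration.integral_cong
          simp: mult_add_distrib_mat_vec[OF e Jz gt])
    finally show ?thesis .
  qed
  have gJ: "J *\<^sub>v z + g t \<in> carrier_vec n" if "t \<in> {0..T}" for t using Jz g[OF that] by auto
  have cJ: "continuous_on {0..T} (\<lambda>t. (J *\<^sub>v z + g t) $ i)" if i: "i < n" for i
  proof (rule continuous_on_eq)
    show "continuous_on {0..T} (\<lambda>t. (J *\<^sub>v z) $ i + g t $ i)" by (intro continuous_intros cont i)
    show "(J *\<^sub>v z) $ i + g t $ i = (J *\<^sub>v z + g t) $ i" if "t \<in> {0..T}" for t
      using carrier_vecD[OF g[OF that]] i by simp
  qed
  note v = variation_of_constants[OF J T gJ cJ]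
  have uC1: "C1_with_deriv {0..T} n u (\<lambda>t. J *\<^sub>v u t + (J *\<^sub>v z + g t))"
    by (rule C1_with_deriv_transform[OF v(1)]) (simp_all add: u_eq)
  have uc: "u t \<in> carrier_vec n" if "t \<in> {0..T}" for t using C1_with_derivD(1)[OF uC1 that] .
  show "C1_with_deriv {0..T} n (\<lambda>t. z + u t) (\<lambda>t. J *\<^sub>v (z + u t) + g t)"
  proof (rule C1_with_deriv_transform[OF C1_with_deriv_add[OF C1_with_deriv_const[OF z] uC1]])
    fix t assume t: "t \<in> {0..T}"
    have Ju: "J *\<^sub>v u t \<in> carrier_vec n" by (rule mult_mat_vec_carrier[OF J uc[OF t]])
    show "J *\<^sub>v (z + u t) + g t = 0\<^sub>v n + (J *\<^sub>v u t + (J *\<^sub>v z + g t))"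
      unfolding mult_add_distrib_mat_vec[OF J z uc[OF t]]
      using carrier_vecD[OF Jz] carrier_vecD[OF Ju] carrier_vecD[OF g[OF t]]
      by (intro eq_vecI) auto
  qed auto
  show "u 0 = 0\<^sub>v n" using u_eq[of 0] v(2) T by simp
qed

text \<open>Applied to an initial value \<open>z\<close>, this matrix gives \<open>B\<^sub>1\<close> of the initial value plus \<open>C\<^sub>1\<close> of the final value of the
  homogeneous solution that starts at \<open>z\<close>.\<close>

lemma boundary_matrix_mult_vec:
  assumes J: "J \<in> carrier_mat n n" and B1: "B1 \<in> carrier_mat n n" and C1: "C1 \<in> carrier_mat n n"
    and z: "z \<in> carrier_vec n"
  shows "(B1 + C1 + C1 * J * mat_integral n 0 T (\<lambda>s. mat_exp ((T - s) \<cdot>\<^sub>m J))) *\<^sub>v z =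
    B1 *\<^sub>v z + C1 *\<^sub>v (z + mat_integral n 0 T (\<lambda>s. mat_exp ((T - s) \<cdot>\<^sub>m J)) *\<^sub>v (J *\<^sub>v z))"
    (is "(_ + _ + _ * ?I) *\<^sub>v _ = _")
proof -
  have I: "?I \<in> carrier_mat n n" unfolding mat_integral_def by simp
  have "C1 * J * ?I = C1 * (?I * J)"
    using assoc_mult_mat[OF C1 J I] mat_integral_exp_commute[OF J] by simp
  then have "(C1 * J * ?I) *\<^sub>v z = C1 *\<^sub>v (?I *\<^sub>v (J *\<^sub>v z))"
    using assoc_mult_mat_vec[OF C1 mult_carrier_mat[OF I J] z] assoc_mult_mat_vec[OF I J z] by simp
  moreover have "C1 * J * ?I \<in> carrier_mat n n" using C1 J I by simp
  moreover have c: "?I *\<^sub>v (J *\<^sub>v z) \<in> carrier_vec n"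
    by (intro mult_mat_vec_carrier[OF I] mult_mat_vec_carrier[OF J] z)
  ultimately have "(B1 + C1 + C1 * J * ?I) *\<^sub>v z =
      (B1 *\<^sub>v z + C1 *\<^sub>v z) + C1 *\<^sub>v (?I *\<^sub>v (J *\<^sub>v z))"
    using add_mult_distrib_mat_vec[of "B1 + C1" n n "C1 * J * ?I" z]
      add_mult_distrib_mat_vec[OF B1 C1 z] B1 C1 z by simp
  also have "\<dots> = B1 *\<^sub>v z + C1 *\<^sub>v (z + ?I *\<^sub>v (J *\<^sub>v z))"
    unfolding mult_add_distrib_mat_vec[OF C1 z c]
    by (rule assoc_add_vec) (auto intro!: mult_mat_vec_carrier[OF B1] mult_mat_vec_carrier[OF C1] z c)
  finally show ?thesis .
qed

text \<open>The function \<open>z\<close> and the solution \<open>y\<close> given by the integral formula have the same initial value, so they are both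
  \<open>e\<^bsup>tJ\<^esup> z(0)\<close>. The integral formula for \<open>y(T)\<close> turns the boundary condition into \<open>D z(0) = 0\<close>.\<close>

lemma homogeneous_linear_bvp:
  assumes J: "J \<in> carrier_mat n n" and T: "0 < T"
    and B1: "B1 \<in> carrier_mat n n" and C1: "C1 \<in> carrier_mat n n"
    and D: "invertible_mat (B1 + C1 + C1 * J * mat_integral n 0 T (\<lambda>s. mat_exp ((T - s) \<cdot>\<^sub>m J)))"
      (is "invertible_mat ?D")
    and z: "C1_with_deriv {0..T} n z z'"
    and ode: "\<And>t. t \<in> {0<..<T} \<Longrightarrow> z' t = J *\<^sub>v z t"
    and bc: "B1 *\<^sub>v z 0 + C1 *\<^sub>v z T = 0\<^sub>v n"
    and t: "t \<in> {0..T}"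
  shows "z t = 0\<^sub>v n"
proof -
  note e = mat_exp_carrier[OF J]
  have zt: "z t = mat_exp (t \<cdot>\<^sub>m J) *\<^sub>v z 0" if "t \<in> {0..T}" for t
    by (rule C1_linear_ode_solution[OF J T z ode that])
  have z0: "z 0 \<in> carrier_vec n" using C1_with_derivD(1)[OF z] T by simp
  let ?I = "mat_integral n 0 T (\<lambda>s. mat_exp ((T - s) \<cdot>\<^sub>m J))"
  \<comment> \<open>Without forcing, the solution formula gives a second description of \<open>z\<close>.\<close>
  define g where "g t = (0\<^sub>v n :: real vec)" for t :: real
  define y where "y t = z 0 + (mat_integral n 0 t (\<lambda>s. mat_exp ((t - s) \<cdot>\<^sub>m J)) *\<^sub>v (J *\<^sub>v z 0)
      + vec_integral n 0 t (\<lambda>s. mat_exp ((t - s) \<cdot>\<^sub>m J) *\<^sub>v g s))" for t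
  have gc: "g t \<in> carrier_vec n" "i < n \<Longrightarrow> continuous_on {0..T} (\<lambda>t. g t $ i)" for t i
    unfolding g_def by auto
  note y = forced_linear_ode_solution[OF J T z0 gc, folded y_def]
  have yc: "y t \<in> carrier_vec n" if "t \<in> {0..T}" for t using C1_with_derivD(1)[OF y(1) that] .
  have "y T = mat_exp (T \<cdot>\<^sub>m J) *\<^sub>v y 0"
  proof (rule C1_linear_ode_solution[OF J T y(1)])
    show "J *\<^sub>v y t + g t = J *\<^sub>v y t" if "t \<in> {0<..<T}" for t
      using mult_mat_vec_carrier[OF J yc, of t] that unfolding g_def by simp
  qed (use T in auto)
  moreover have "y 0 = z 0" unfolding y_def by (subst y(2)) (simp_all add: right_zero_vec[OF z0])
  ultimately have "y T = z T" using zt[of T] T by simp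
  moreover have "y T = z 0 + ?I *\<^sub>v (J *\<^sub>v z 0)"
  proof -
    have "mat_exp (r \<cdot>\<^sub>m J) *\<^sub>v 0\<^sub>v n = 0\<^sub>v n" for r using e[of r] by (intro eq_vecI) auto
    then have "vec_integral n 0 T (\<lambda>s. mat_exp ((T - s) \<cdot>\<^sub>m J) *\<^sub>v g s) = 0\<^sub>v n"
      unfolding g_def vec_integral_def by (intro eq_vecI) auto
    moreover have "?I *\<^sub>v (J *\<^sub>v z 0) \<in> carrier_vec n"
      unfolding mat_integral_def by (rule mult_mat_vec_carrier[OF _ mult_mat_vec_carrier[OF J z0]]) simp
    ultimately show ?thesis unfolding y_def by simp
  qed
  ultimately have "?D *\<^sub>v z 0 = 0\<^sub>v n" using boundary_matrix_mult_vec[OF J B1 C1 z0, of T] bc by simp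
  moreover have Dc: "?D \<in> carrier_mat n n"
    using J B1 C1 by (auto simp: mat_integral_def)
  note Di = inv_mat_props[OF Dc D]
  ultimately have "z 0 = inv_mat ?D *\<^sub>v 0\<^sub>v n"
    using assoc_mult_mat_vec[OF Di(1) Dc z0] Di(3) z0 by simp
  also have "\<dots> = 0\<^sub>v n" using Di(1) by (intro eq_vecI) auto
  finally show ?thesis using zt[OF t] e[of t] by (auto intro!: eq_vecI)
qed

section \<open>Existence and uniqueness\<close>

theorem theorem2p4:
  fixes T :: real and n n1 n2 \<nu> :: nat
    and E A P Q J N B1 B2 C1 C2 Bt Ct B C Dt :: "real mat"
    and d1 d dt \<mu>1 \<mu>2 :: "real vec"
    and f f1 f2 u1 u2 x :: "real \<Rightarrow> real vec"
  assumes T: "T > 0"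
    and E: "E \<in> carrier_mat n n" and A: "A \<in> carrier_mat n n"
    and regular: "regular_pair E A"
    and form: "weierstrass_form n E A P Q n1 J n2 N"
    and \<nu>: "\<nu> = pair_index E A"
    and f: "vec_Ck_on \<nu> {0..T} n f"
    and f1: "f1 = (\<lambda>t. vec_first (P *\<^sub>v f t) n1)"
    and f2: "f2 = (\<lambda>t. vec_last (P *\<^sub>v f t) n2)"
    and B1: "B1 \<in> carrier_mat n1 n1" and C1: "C1 \<in> carrier_mat n1 n1"
    and B2: "B2 \<in> carrier_mat n1 n2" and C2: "C2 \<in> carrier_mat n1 n2"
    and d1: "d1 \<in> carrier_vec n1"
    and Bt: "Bt = four_block_mat B1 B2 (0\<^sub>m n2 n1) (0\<^sub>m n2 n2)"
    and Ct: "Ct = four_block_mat C1 C2 (0\<^sub>m n2 n1) (0\<^sub>m n2 n2)"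
    and B: "B = Bt * inv_mat Q" and C: "C = Ct * inv_mat Q"
    and d: "d = d1 @\<^sub>v 0\<^sub>v n2"
    and Dt: "Dt = B1 + C1 + C1 * J * mat_integral n1 0 T (\<lambda>s. mat_exp ((T - s) \<cdot>\<^sub>m J))"
    and Dt_inv: "invertible_mat Dt"
    and dt: "dt = d1 - C1 *\<^sub>v vec_integral n1 0 T (\<lambda>s. mat_exp ((T - s) \<cdot>\<^sub>m J) *\<^sub>v f1 s)
       + B2 *\<^sub>v finsum_vec TYPE(real) n2 (\<lambda>i. (N ^\<^sub>m i) *\<^sub>v vec_nth_deriv_on {0..T} i f2 0) {..<\<nu>}
       + C2 *\<^sub>v finsum_vec TYPE(real) n2 (\<lambda>i. (N ^\<^sub>m i) *\<^sub>v vec_nth_deriv_on {0..T} i f2 T) {..<\<nu>}"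
    and \<mu>1: "\<mu>1 = inv_mat Dt *\<^sub>v dt"
    and u1: "u1 = (\<lambda>t.
         mat_integral n1 0 t (\<lambda>s. mat_exp ((t - s) \<cdot>\<^sub>m J)) *\<^sub>v (J *\<^sub>v (inv_mat Dt *\<^sub>v dt))
         + vec_integral n1 0 t (\<lambda>s. mat_exp ((t - s) \<cdot>\<^sub>m J) *\<^sub>v f1 s))"
    and \<mu>2: "\<mu>2 = - finsum_vec TYPE(real) n2
         (\<lambda>i. (N ^\<^sub>m i) *\<^sub>v vec_nth_deriv_on {0..T} i f2 0) {..<\<nu>}"
    and u2: "u2 = (\<lambda>t. - finsum_vec TYPE(real) n2
         (\<lambda>i. (N ^\<^sub>m i) *\<^sub>v
            (vec_nth_deriv_on {0..T} i f2 t - vec_nth_deriv_on {0..T} i f2 0)) {..<\<nu>})"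
    and x: "x = (\<lambda>t. Q *\<^sub>v ((\<mu>1 @\<^sub>v \<mu>2) + (u1 t @\<^sub>v u2 t)))"
  shows "bvp_solution n T E A f B C d x \<and>
    (\<forall>y. bvp_solution n T E A f B C d y \<longrightarrow> (\<forall>t\<in>{0..T}. y t = x t))"
proof -
  note w = form[unfolded weierstrass_form_def]
  have n: "n1 + n2 = n" and P: "P \<in> carrier_mat n n" "invertible_mat P"
    and Q: "Q \<in> carrier_mat n n" "invertible_mat Q" and J: "J \<in> carrier_mat n1 n1"
    and N: "N \<in> carrier_mat n2 n2" using w by auto
  note Qi = inv_mat_props[OF Q]
  have nil: "N ^\<^sub>m \<nu> = 0\<^sub>m n2 n2" unfolding \<nu> by (rule pow_pair_index_zero[OF E A form])
  note Np = pow_carrier_mat[OF N]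

  have Pf: "vec_Ck_on \<nu> {0..T} (n1 + n2) (\<lambda>t. P *\<^sub>v f t)"
    unfolding n by (rule vec_Ck_on_mult_mat[OF P(1) f T])
  have Pfc: "P *\<^sub>v f t \<in> carrier_vec (n1 + n2)" for t
    unfolding n using P(1) by (intro carrier_vecI) simp
  have f1_Ck: "vec_Ck_on \<nu> {0..T} n1 f1" unfolding f1 by (rule vec_Ck_on_vec_first[OF Pf])
  have f2_Ck: "vec_Ck_on \<nu> {0..T} n2 f2" unfolding f2 by (rule vec_Ck_on_vec_last[OF Pf Pfc])
  have f1c: "f1 t \<in> carrier_vec n1" and f2c: "f2 t \<in> carrier_vec n2" for t
    unfolding f1 f2 by auto
  have f1_cont: "continuous_on {0..T} (\<lambda>t. f1 t $ i)" if "i < n1" for i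
    using f1_Ck that Ck_on_derivs(2)[OF _ T, of \<nu> "\<lambda>t. f1 t $ i" 0] unfolding vec_Ck_on_def by auto

  define F where "F i t = vec_nth_deriv_on {0..T} i f2 t" for i t
  have F0: "F 0 t = f2 t" for t unfolding F_def by (rule vec_nth_deriv_on_0)
  have F_C1: "C1_with_deriv {0..T} n2 (F i) (F (Suc i))" if "i < \<nu>" for i
    unfolding F_def[abs_def] by (rule vec_Ck_on_C1_derivs[OF f2_Ck T that])
  have Fc: "F i t \<in> carrier_vec n2" for i t
    using f2c[of t] unfolding F_def vec_nth_deriv_on_def by auto
  define S where "S t = finsum_vec TYPE(real) n2 (\<lambda>i. N ^\<^sub>m i *\<^sub>v F i t) {..<\<nu>}" for t
  have NFc: "N ^\<^sub>m i *\<^sub>v F i t \<in> carrier_vec n2" for i t by (rule mult_mat_vec_carrier[OF Np Fc])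
  have Sc: "S t \<in> carrier_vec n2" for t unfolding S_def by (rule finsum_vec_closed) (use NFc in auto)
  define x2' where "x2' t = - finsum_vec TYPE(real) n2 (\<lambda>i. N ^\<^sub>m i *\<^sub>v F (Suc i) t) {..<\<nu>}" for t
  have x2_C1: "C1_with_deriv {0..T} n2 (\<lambda>t. - S t) x2'"
    and x2_dae: "\<And>t. t \<in> {0..T} \<Longrightarrow> N *\<^sub>v x2' t = - S t + f2 t"
    using nilpotent_dae_solution[where F = F, OF N nil F_C1 Fc] unfolding S_def x2'_def[abs_def] F0 by auto
  \<comment> \<open>The values at \<open>0\<close> in the two summands cancel.\<close>
  have x2: "\<mu>2 + u2 t = - S t" for t
  proof (rule eq_vecI)
    fix j assume "j < dim_vec (- S t)"
    then have j: "j < n2" using Sc[of t] by simp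
    have d: "F i t - F i 0 \<in> carrier_vec n2" for i using Fc by auto
    have Nd: "N ^\<^sub>m i *\<^sub>v (F i t - F i 0) = N ^\<^sub>m i *\<^sub>v F i t - N ^\<^sub>m i *\<^sub>v F i 0" for i
      by (rule mult_minus_distrib_mat_vec[OF Np Fc Fc])
    let ?D = "finsum_vec TYPE(real) n2 (\<lambda>i. N ^\<^sub>m i *\<^sub>v (F i t - F i 0)) {..<\<nu>}"
    have Dc: "?D \<in> carrier_vec n2"
      by (rule finsum_vec_closed) (auto intro!: mult_mat_vec_carrier[OF Np] d)
    have "?D $ j = (\<Sum>i<\<nu>. (N ^\<^sub>m i *\<^sub>v F i t - N ^\<^sub>m i *\<^sub>v F i 0) $ j)"
      unfolding Nd by (rule index_finsum_vec) (use NFc j in auto)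
    also have "\<dots> = (\<Sum>i<\<nu>. (N ^\<^sub>m i *\<^sub>v F i t) $ j - (N ^\<^sub>m i *\<^sub>v F i 0) $ j)"
      by (rule sum.cong[OF refl], subst index_minus_vec) (use carrier_vecD[OF NFc] j in auto)
    also have "\<dots> = S t $ j - S 0 $ j"
      unfolding sum_subtractf S_def
      by (subst (1 2) index_finsum_vec) (use NFc j in auto)
    finally have "?D $ j = S t $ j - S 0 $ j" .
    moreover have "\<mu>2 = - S 0" "u2 t = - ?D" unfolding \<mu>2 u2 S_def F_def by auto
    ultimately show "(\<mu>2 + u2 t) $ j = (- S t) $ j"
      using j carrier_vecD[OF Dc] carrier_vecD[OF Sc] by simp
  next
    have "finsum_vec TYPE(real) n2 (\<lambda>i. N ^\<^sub>m i *\<^sub>v (F i t - F i 0)) {..<\<nu>} \<in> carrier_vec n2"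
      by (rule finsum_vec_closed) (auto intro!: mult_mat_vec_carrier[OF Np] minus_carrier_vec Fc)
    then show "dim_vec (\<mu>2 + u2 t) = dim_vec (- S t)"
      using Sc[of t] unfolding u2 F_def by simp
  qed

  define I where "I = mat_integral n1 0 T (\<lambda>s. mat_exp ((T - s) \<cdot>\<^sub>m J))"
  define V where "V = vec_integral n1 0 T (\<lambda>s. mat_exp ((T - s) \<cdot>\<^sub>m J) *\<^sub>v f1 s)"
  have Ic: "I \<in> carrier_mat n1 n1" and Vc: "V \<in> carrier_vec n1"
    unfolding I_def V_def mat_integral_def vec_integral_def by auto
  have Dtc: "Dt \<in> carrier_mat n1 n1" unfolding Dt using B1 C1 J by (auto simp: mat_integral_def)
  note Di = inv_mat_props[OF Dtc Dt_inv]
  have dt_eq: "dt = d1 - C1 *\<^sub>v V + B2 *\<^sub>v S 0 + C2 *\<^sub>v S T"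
    unfolding dt V_def S_def F_def by simp
  have c: "C1 *\<^sub>v V \<in> carrier_vec n1" "B2 *\<^sub>v S t \<in> carrier_vec n1" "C2 *\<^sub>v S t \<in> carrier_vec n1" for t
    using Vc Sc B2 C1 C2 by (auto intro!: mult_mat_vec_carrier)
  have dtc: "dt \<in> carrier_vec n1" unfolding dt_eq using c d1 by auto
  have \<mu>1c: "\<mu>1 \<in> carrier_vec n1" unfolding \<mu>1 by (rule mult_mat_vec_carrier[OF Di(1) dtc])
  have Dt_\<mu>1: "Dt *\<^sub>v \<mu>1 = dt"
    unfolding \<mu>1 using assoc_mult_mat_vec[OF Dtc Di(1) dtc] Di(2) dtc by simp
  have J\<mu>1: "J *\<^sub>v \<mu>1 \<in> carrier_vec n1" by (rule mult_mat_vec_carrier[OF J \<mu>1c])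
  define x1 where "x1 t = \<mu>1 + u1 t" for t
  have x1_C1: "C1_with_deriv {0..T} n1 x1 (\<lambda>t. J *\<^sub>v x1 t + f1 t)" and u1_0: "u1 0 = 0\<^sub>v n1"
    using forced_linear_ode_solution[OF J T \<mu>1c f1c f1_cont]
    unfolding x1_def[abs_def] u1 \<mu>1[symmetric] by auto
  have x1c: "x1 t \<in> carrier_vec n1" for t
    unfolding x1_def u1 by (intro carrier_vecI) (simp add: vec_integral_def)

  have x_eq: "x t = Q *\<^sub>v (x1 t @\<^sub>v (- S t))" for t
  proof -
    have "u1 t \<in> carrier_vec n1" unfolding u1 by (intro carrier_vecI) (simp add: vec_integral_def)
    moreover have "\<mu>2 \<in> carrier_vec n2" using Sc[of 0] unfolding \<mu>2 S_def F_def by simp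
    moreover have "u2 t \<in> carrier_vec n2"
      using arg_cong[OF x2[of t], of dim_vec] carrier_vecD[OF Sc[of t]] by (intro carrier_vecI) simp
    ultimately show ?thesis
      unfolding x x1_def x2[of t, symmetric] using \<mu>1c by (subst append_vec_add[of _ n1 _ _ n2]) auto
  qed

  have x_C1: "C1_with_deriv {0..T} n x (\<lambda>t. Q *\<^sub>v ((J *\<^sub>v x1 t + f1 t) @\<^sub>v x2' t))"
    unfolding x_eq[abs_def]
    by (rule C1_with_deriv_mult_mat[OF Q(1)])
      (use C1_with_deriv_append[OF x1_C1 x2_C1] n in simp)
  have x_dae: "E *\<^sub>v (Q *\<^sub>v ((J *\<^sub>v x1 t + f1 t) @\<^sub>v x2' t)) = A *\<^sub>v x t + f t" if t: "t \<in> {0<..<T}" for t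
  proof -
    have t': "t \<in> {0..T}" using t by auto
    have ft: "f t \<in> carrier_vec n" using f t' unfolding vec_Ck_on_def by auto
    show ?thesis unfolding x_eq
      using weierstrass_decoupling[OF E A form x1c C1_with_derivD(2)[OF x1_C1 t']
          uminus_carrier_vec[THEN iffD2, OF Sc] C1_with_derivD(2)[OF x2_C1 t'] ft] x2_dae[OF t']
      by (simp add: f1 f2)
  qed
  have bc_mult: "B *\<^sub>v (Q *\<^sub>v (a @\<^sub>v b)) + C *\<^sub>v (Q *\<^sub>v (a' @\<^sub>v b')) =
      (B1 *\<^sub>v a + B2 *\<^sub>v b + (C1 *\<^sub>v a' + C2 *\<^sub>v b')) @\<^sub>v 0\<^sub>v n2"
    if "a \<in> carrier_vec n1" "a' \<in> carrier_vec n1" "b \<in> carrier_vec n2" "b' \<in> carrier_vec n2"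
    for a a' b b'
  proof -
    have "B1 *\<^sub>v a + B2 *\<^sub>v b \<in> carrier_vec n1" "C1 *\<^sub>v a' + C2 *\<^sub>v b' \<in> carrier_vec n1"
      using that B1 B2 C1 C2 by (auto intro!: mult_mat_vec_carrier add_carrier_vec)
    then show ?thesis
      unfolding B C Bt Ct boundary_block_mult[OF Q n B1 B2 that(1,3)]
        boundary_block_mult[OF Q n C1 C2 that(2,4)]
      by (subst append_vec_add[of _ n1 _ _ n2]) auto
  qed
  have x_bc: "B *\<^sub>v x 0 + C *\<^sub>v x T = d"
  proof -
    have x1_0: "x1 0 = \<mu>1" unfolding x1_def u1_0 using \<mu>1c by simp
    have IJ: "I *\<^sub>v (J *\<^sub>v \<mu>1) \<in> carrier_vec n1" by (rule mult_mat_vec_carrier[OF Ic J\<mu>1])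
    have "x1 T = (\<mu>1 + I *\<^sub>v (J *\<^sub>v \<mu>1)) + V"
      unfolding x1_def u1 I_def[symmetric] V_def[symmetric] \<mu>1[symmetric]
      by (rule assoc_add_vec[symmetric, OF \<mu>1c IJ Vc])
    then have "C1 *\<^sub>v x1 T = C1 *\<^sub>v (\<mu>1 + I *\<^sub>v (J *\<^sub>v \<mu>1)) + C1 *\<^sub>v V"
      using mult_add_distrib_mat_vec[OF C1 _ Vc] \<mu>1c IJ by simp
    moreover have "B1 *\<^sub>v \<mu>1 + C1 *\<^sub>v (\<mu>1 + I *\<^sub>v (J *\<^sub>v \<mu>1)) = dt"
      using boundary_matrix_mult_vec[OF J B1 C1 \<mu>1c, of T] Dt_\<mu>1 unfolding Dt I_def by simp
    moreover have "B1 *\<^sub>v \<mu>1 \<in> carrier_vec n1" "C1 *\<^sub>v (\<mu>1 + I *\<^sub>v (J *\<^sub>v \<mu>1)) \<in> carrier_vec n1"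
      using B1 C1 \<mu>1c IJ by (auto intro!: mult_mat_vec_carrier)
    moreover have "B2 *\<^sub>v (- S 0) = - (B2 *\<^sub>v S 0)" "C2 *\<^sub>v (- S T) = - (C2 *\<^sub>v S T)"
      by (intro mult_mat_vec_uminus[OF B2 Sc] mult_mat_vec_uminus[OF C2 Sc])+
    ultimately have "B1 *\<^sub>v x1 0 + B2 *\<^sub>v (- S 0) + (C1 *\<^sub>v x1 T + C2 *\<^sub>v (- S T)) =
        dt + C1 *\<^sub>v V - B2 *\<^sub>v S 0 - C2 *\<^sub>v S T"
      unfolding x1_0 using carrier_vecD[OF c(1)] carrier_vecD[OF c(2)[of 0]] carrier_vecD[OF c(3)[of T]]
      by (intro eq_vecI) auto
    also have "\<dots> = d1"
      unfolding dt_eq using carrier_vecD[OF c(1)] carrier_vecD[OF c(2)[of 0]] carrier_vecD[OF c(3)[of T]]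
        carrier_vecD[OF d1]
      by (intro eq_vecI) auto
    finally show ?thesis
      unfolding x_eq d by (subst bc_mult) (use x1c Sc in auto)
  qed

  show ?thesis
  proof (intro conjI allI impI ballI)
    show "bvp_solution n T E A f B C d x"
      unfolding bvp_solution_iff_C1[OF T] using x_C1 x_dae x_bc by blast
    fix y t assume "bvp_solution n T E A f B C d y" and t: "t \<in> {0..T}"
    then obtain y' where y_C1: "C1_with_deriv {0..T} n y y'"
      and y_dae: "\<And>t. t \<in> {0<..<T} \<Longrightarrow> E *\<^sub>v y' t = A *\<^sub>v y t + f t"
      and y_bc: "B *\<^sub>v y 0 + C *\<^sub>v y T = d"
      unfolding bvp_solution_iff_C1[OF T] by auto
    \<comment> \<open>The difference of the two solutions, in the coordinates of the canonical form.\<close>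
    define x' where "x' t = Q *\<^sub>v ((J *\<^sub>v x1 t + f1 t) @\<^sub>v x2' t)" for t
    define z where "z t = inv_mat Q *\<^sub>v (y t - x t)" for t
    define z' where "z' t = inv_mat Q *\<^sub>v (y' t - x' t)" for t
    note xD = C1_with_derivD[OF x_C1, folded x'_def] and yD = C1_with_derivD[OF y_C1]
    have "C1_with_deriv {0..T} (n1 + n2) z z'"
      unfolding z_def[abs_def] z'_def[abs_def] n
      by (intro C1_with_deriv_mult_mat[OF Qi(1)] C1_with_deriv_diff y_C1)
        (use x_C1 in \<open>simp add: x'_def\<close>)
    note z_C1 = this and z1_C1 = C1_with_deriv_vec_first[OF this] and z2_C1 = C1_with_deriv_vec_last[OF this]
    let ?z1 = "\<lambda>t. vec_first (z t) n1" and ?z2 = "\<lambda>t. vec_last (z t) n2"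
    let ?z1' = "\<lambda>t. vec_first (z' t) n1" and ?z2' = "\<lambda>t. vec_last (z' t) n2"
    have Qz: "Q *\<^sub>v (?z1 t @\<^sub>v ?z2 t) = y t - x t" "Q *\<^sub>v (?z1' t @\<^sub>v ?z2' t) = y' t - x' t"
      if "t \<in> {0..T}" for t
    proof -
      have v: "y t - x t \<in> carrier_vec n" "y' t - x' t \<in> carrier_vec n"
        using xD(1,2)[OF that] yD(1,2)[OF that] by auto
      have "?z1 t @\<^sub>v ?z2 t = z t" "?z1' t @\<^sub>v ?z2' t = z' t"
        using C1_with_derivD(1,2)[OF z_C1 that] by auto
      then show "Q *\<^sub>v (?z1 t @\<^sub>v ?z2 t) = y t - x t" "Q *\<^sub>v (?z1' t @\<^sub>v ?z2' t) = y' t - x' t"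
        unfolding z_def z'_def
        using assoc_mult_mat_vec[OF Q(1) Qi(1) v(1)] assoc_mult_mat_vec[OF Q(1) Qi(1) v(2)] Qi(2) v
        by auto
    qed
    have z_dae: "?z1' t = J *\<^sub>v ?z1 t \<and> N *\<^sub>v ?z2' t = ?z2 t" if t: "t \<in> {0<..<T}" for t
    proof -
      have t': "t \<in> {0..T}" using t by auto
      note v = xD(1,2)[OF t'] yD(1,2)[OF t']
      have ft: "f t \<in> carrier_vec n" using f t' unfolding vec_Ck_on_def by auto
      have P0: "P *\<^sub>v 0\<^sub>v n = 0\<^sub>v n" using P by (intro eq_vecI) auto
      have v0: "vec_first (0\<^sub>v n) n1 = (0\<^sub>v n1 :: real vec)" "vec_last (0\<^sub>v n) n2 = (0\<^sub>v n2 :: real vec)"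
        using n unfolding vec_first_def vec_last_def by (auto intro!: eq_vecI)
      have "E *\<^sub>v (y' t - x' t) = (A *\<^sub>v y t + f t) - (A *\<^sub>v x t + f t)"
        using mult_minus_distrib_mat_vec[OF E v(4,2)] y_dae[OF t] x_dae[OF t]
        unfolding x'_def by simp
      also have "\<dots> = A *\<^sub>v y t - A *\<^sub>v x t"
        using carrier_matD(1)[OF A] carrier_vecD[OF ft]
        by (intro eq_vecI) (auto simp del: index_mult_mat_vec)
      also have "\<dots> = A *\<^sub>v (y t - x t) + 0\<^sub>v n"
        using mult_minus_distrib_mat_vec[OF A v(3,1)] mult_mat_vec_carrier[OF A v(3)]
          mult_mat_vec_carrier[OF A v(1)] by simp
      finally have "E *\<^sub>v (Q *\<^sub>v (?z1' t @\<^sub>v ?z2' t)) = A *\<^sub>v (Q *\<^sub>v (?z1 t @\<^sub>v ?z2 t)) + 0\<^sub>v n"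
        unfolding Qz[OF t'] .
      then have "?z1' t = J *\<^sub>v ?z1 t + 0\<^sub>v n1 \<and> N *\<^sub>v ?z2' t = ?z2 t + 0\<^sub>v n2"
        by (subst (asm) weierstrass_decoupling[OF E A form]) (auto simp: P0 v0)
      then show ?thesis using mult_mat_vec_carrier[OF J vec_first_carrier] by simp
    qed
    \<comment> \<open>The second component has to vanish first: only then is the boundary condition one for \<open>z\<^sub>1\<close> alone.\<close>
    have z2: "?z2 t = 0\<^sub>v n2" if "t \<in> {0..T}" for t
      by (rule homogeneous_nilpotent_dae[OF N nil T z2_C1 _ that]) (use z_dae in auto)
    have "?z1 t = 0\<^sub>v n1" if "t \<in> {0..T}" for t
    proof (rule homogeneous_linear_bvp[OF J T B1 C1 Dt_inv[unfolded Dt] z1_C1 _ _ that])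
      have T0: "0 \<in> {0..T}" "T \<in> {0..T}" using T by auto
      have Bc: "B \<in> carrier_mat n n" "C \<in> carrier_mat n n"
        unfolding B C Bt Ct using B1 B2 C1 C2 Qi(1) n by auto
      note v = xD(1)[OF T0(1)] xD(1)[OF T0(2)] yD(1)[OF T0(1)] yD(1)[OF T0(2)]
      have "B *\<^sub>v (y 0 - x 0) + C *\<^sub>v (y T - x T) = (B *\<^sub>v y 0 + C *\<^sub>v y T) - (B *\<^sub>v x 0 + C *\<^sub>v x T)"
        unfolding mult_minus_distrib_mat_vec[OF Bc(1) v(3,1)] mult_minus_distrib_mat_vec[OF Bc(2) v(4,2)]
        using carrier_matD(1)[OF Bc(1)] carrier_matD(1)[OF Bc(2)]
        by (intro eq_vecI) (auto simp del: index_mult_mat_vec)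
      also have "\<dots> = 0\<^sub>v n1 @\<^sub>v 0\<^sub>v n2" unfolding x_bc y_bc d using d1 by (intro eq_vecI) auto
      finally have "B *\<^sub>v (Q *\<^sub>v (?z1 0 @\<^sub>v ?z2 0)) + C *\<^sub>v (Q *\<^sub>v (?z1 T @\<^sub>v ?z2 T)) = 0\<^sub>v n1 @\<^sub>v 0\<^sub>v n2"
        unfolding Qz[OF T0(1)] Qz[OF T0(2)] .
      then have "(B1 *\<^sub>v ?z1 0 + B2 *\<^sub>v 0\<^sub>v n2 + (C1 *\<^sub>v ?z1 T + C2 *\<^sub>v 0\<^sub>v n2)) @\<^sub>v 0\<^sub>v n2
          = 0\<^sub>v n1 @\<^sub>v 0\<^sub>v n2"
        unfolding z2[OF T0(1)] z2[OF T0(2)] by (subst (asm) bc_mult) auto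
      moreover have "B2 *\<^sub>v 0\<^sub>v n2 = 0\<^sub>v n1" "C2 *\<^sub>v 0\<^sub>v n2 = 0\<^sub>v n1"
        using B2 C2 by (auto intro!: eq_vecI)
      moreover have "B1 *\<^sub>v ?z1 0 \<in> carrier_vec n1" "C1 *\<^sub>v ?z1 T \<in> carrier_vec n1"
        using B1 C1 by (auto intro!: mult_mat_vec_carrier)
      ultimately show "B1 *\<^sub>v ?z1 0 + C1 *\<^sub>v ?z1 T = 0\<^sub>v n1"
        by (subst (asm) append_vec_eq[of _ n1]) auto
    qed (use z_dae in auto)
    then have "y t - x t = Q *\<^sub>v (0\<^sub>v n1 @\<^sub>v 0\<^sub>v n2)" using Qz(1)[OF t] z2[OF t] t by simp
    also have "0\<^sub>v n1 @\<^sub>v 0\<^sub>v n2 = (0\<^sub>v n :: real vec)" using n by (intro eq_vecI) auto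
    also have "Q *\<^sub>v 0\<^sub>v n = 0\<^sub>v n" using Q by (intro eq_vecI) auto
    finally have diff: "y t - x t = 0\<^sub>v n" .
    show "y t = x t"
    proof (rule eq_vecI)
      fix i assume "i < dim_vec (x t)"
      then have i: "i < n" using xD(1)[OF t] by simp
      then show "y t $ i = x t $ i"
        using arg_cong[OF diff, of "\<lambda>v. v $ i"] carrier_vecD[OF xD(1)[OF t]] by simp
    qed (use carrier_vecD[OF xD(1)[OF t]] carrier_vecD[OF yD(1)[OF t]] in simp)
  qed
qed

end
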